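(* For all integers $n\ge 9$, $$\mathrm{ex}(n,\overrightarrow{P_{1,3}})=a(\overrightarrow{S_n})=\left\lfloor\frac{n^2}{3}\right\rfloor .$$ Furthermore, $\mathrm{EX}(n,\overrightarrow{P_{1,3}})=\overrightarrow{\mathcal{S}_n}$.
   Context: Digraphs are finite and strict: no loops and no parallel arcs in the same direction, but both arcs $uv$ and $vu$ may be present. $a(D)$ denotes the number of arcs of a digraph $D$. $\overrightarrow{P_{1,3}}$ is the digraph with four distinct vertices $a,b,c,d$ and arcs $ab$, $bc$, $cd$, $ad$ (an orientation of the $4$-cycle). A digraph is $H$-free if it contains no (not necessarily induced) subdigraph isomorphic to the digraph $H$. $\mathrm{ex}(n,H)$ is the maximum number of arcs of an $H$-free digraph on $n$ vertices, and $\mathrm{EX}(n,H)$ is the family of all $H$-free digraphs on $n$ vertices with exactly $\mathrm{ex}(n,H)$ arcs. Families of digraphs are considered up to isomorphism. For disjoint vertex sets $U,W$ of a digraph, $U\mapsto W$ means that $uw$ is an arc and $wu$ is not an arc for all $u\in U$, $w\in W$. $\overrightarrow{\mathcal{S}_n}$ is the set of all digraphs $\overrightarrow{S_n}$ on $n$ vertices satisfying: (i) the vertex set has a partition $\{X,Y,Z\}$ whose part sizes differ pairwise by at most $1$; (ii) $X$, $Y$, $Z$ are independent sets (no arcs inside them); (iii) $X$, $Y$, $Z$ have partitions $\{X_1,X_2\}$, $\{Y_1,Y_2\}$, $\{Z_1,Z_2\}$ respectively, where any of the sets $X_i,Y_j,Z_k$ may be empty and there is no restriction on their sizes; (iv)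 $X_1\mapsto Y_1\cup Z_2$, $Y_1\mapsto Z_1\cup X_2$, $Z_1\mapsto X_1\cup Y_2$, $X_2\mapsto Y_2\cup Z_1$, $Y_2\mapsto Z_2\cup X_1$, $Z_2\mapsto X_2\cup Y_1$. All members of $\overrightarrow{\mathcal{S}_n}$ have the same number of arcs, denoted $a(\overrightarrow{S_n})$. *)

theory Defs
  imports Complex_Main "Graph_Theory.Graph_Theory"
begin

text \<open>
  A finite strict digraph is a \<^term>\<open>D :: 'a pair_pre_digraph\<close> satisfying
  \<^term>\<open>pair_digraph D\<close>: its arcs are ordered pairs of vertices (so there are no parallel arcs),
  and it is finite and loop-free; opposite arcs may both be present.

  Families of digraphs on a vertex type are sets of labelled digraphs.  Those below are closed under
  isomorphism, so their equality on a vertex type is equality of the families up to isomorphism.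
\<close>

definition P13 :: "nat pair_pre_digraph" where
  "P13 = \<lparr> pverts = {0, 1, 2, 3}, parcs = {(0, 1), (1, 2), (2, 3), (0, 3)} \<rparr>"

definition free_of :: "'b pair_pre_digraph \<Rightarrow> 'a pair_pre_digraph \<Rightarrow> bool" where
  "free_of H D \<longleftrightarrow> \<not> (\<exists>K. subgraph K (with_proj D) \<and> digraph_iso (with_proj H) K)"

definition free_digraphs :: "nat \<Rightarrow> 'b pair_pre_digraph \<Rightarrow> 'a pair_pre_digraph set" where
  "free_digraphs n H = {D. pair_digraph D \<and> card (pverts D) = n \<and> free_of H D}"

text \<open>
  The maximum is taken over digraphs with vertices in \<^typ>\<open>nat\<close>; every finite digraph is
  isomorphic to one of these.
\<close>

definition ex_arcs :: "nat \<Rightarrow> 'b pair_pre_digraph \<Rightarrow> nat" where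
  "ex_arcs n H = Max ((\<lambda>D :: nat pair_pre_digraph. card (parcs D)) ` free_digraphs n H)"

definition EX_family :: "nat \<Rightarrow> 'b pair_pre_digraph \<Rightarrow> 'a pair_pre_digraph set" where
  "EX_family n H = {D \<in> free_digraphs n H. card (parcs D) = ex_arcs n H}"

definition independent_in :: "'a pair_pre_digraph \<Rightarrow> 'a set \<Rightarrow> bool" where
  "independent_in D U \<longleftrightarrow> (\<forall>u\<in>U. \<forall>w\<in>U. (u, w) \<notin> parcs D)"

definition one_way :: "'a pair_pre_digraph \<Rightarrow> 'a set \<Rightarrow> 'a set \<Rightarrow> bool" where
  "one_way D U W \<longleftrightarrow> (\<forall>u\<in>U. \<forall>w\<in>W. (u, w) \<in> parcs D \<and> (w, u) \<notin> parcs D)"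

text \<open>
  The parts \<open>X = X1 \<union> X2\<close>, \<open>Y = Y1 \<union> Y2\<close>, \<open>Z = Z1 \<union> Z2\<close> and their subparts may be empty.
\<close>

definition S_family :: "nat \<Rightarrow> 'a pair_pre_digraph set" where
  "S_family n = {D. pair_digraph D \<and> card (pverts D) = n \<and>
    (\<exists>X Y Z X1 X2 Y1 Y2 Z1 Z2.
      pverts D = X \<union> Y \<union> Z \<and> X \<inter> Y = {} \<and> X \<inter> Z = {} \<and> Y \<inter> Z = {} \<and>
      (\<forall>A\<in>{X, Y, Z}. \<forall>B\<in>{X, Y, Z}. card A \<le> card B + 1) \<and>
      independent_in D X \<and> independent_in D Y \<and> independent_in D Z \<and>
      X = X1 \<union> X2 \<and> X1 \<inter> X2 = {} \<and>
      Y = Y1 \<union> Y2 \<and> Y1 \<inter> Y2 = {} \<and>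
      Z = Z1 \<union> Z2 \<and> Z1 \<inter> Z2 = {} \<and>
      one_way D X1 (Y1 \<union> Z2) \<and> one_way D Y1 (Z1 \<union> X2) \<and> one_way D Z1 (X1 \<union> Y2) \<and>
      one_way D X2 (Y2 \<union> Z1) \<and> one_way D Y2 (Z2 \<union> X1) \<and> one_way D Z2 (X2 \<union> Y1))}"

text \<open>
  The common number of arcs of the members: the \<open>m\<close> such that the set of their arc numbers
  is \<open>{m}\<close>.
\<close>

definition S_arcs :: "nat \<Rightarrow> nat" where
  "S_arcs n = (THE m. (\<lambda>D :: nat pair_pre_digraph. card (parcs D)) ` S_family n = {m})"

end

theory Submission
  imports Defs
begin

text \<open>
  Forget directions: call two vertices adjacent if some arc joins them, and count an edge twice if it
  is a 2-cycle.  In a digraph without \<open>P13\<close> no four vertices are pairwise adjacent, and a 2-cycle lies in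
  no undirected 4-cycle.  Without 2-cycles Turan's theorem for \<open>K4\<close> gives \<open>n\<^sup>2 / 3\<close>, with equality
  only for balanced complete tripartite graphs.

  With 2-cycles the count stays strictly below \<open>\<lfloor>n\<^sup>2 / 3\<rfloor>\<close> for \<open>n \<ge> 9\<close>, by induction on \<open>n\<close>.  The base case
  is the bound \<open>4 n - 10\<close> for \<open>6 \<le> n \<le> 9\<close>: a vertex of weighted degree at most 4 is removed, and if
  there is none a local analysis of the 2-cycles applies.

  A tripartite orientation avoids \<open>P13\<close> iff every 4-cycle has an even number of forward arcs.  Such an
  orientation is, up to exchanging two parts, the cyclic one with all arcs between two classes of
  vertices reversed, that is, a member of the family.
\<close>

section \<open>2-cycles and the underlying graph\<close>

locale P13_free =
  fixes E :: "('a \<times> 'a) set"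
  assumes irrefl: "(x, x) \<notin> E"
    and P13_free: "\<lbrakk>distinct [a, b, c, d]; (a, b) \<in> E; (b, c) \<in> E; (c, d) \<in> E\<rbrakk> \<Longrightarrow> (a, d) \<notin> E"
begin

definition adj :: "'a \<Rightarrow> 'a \<Rightarrow> bool" where
  "adj x y \<longleftrightarrow> (x, y) \<in> E \<or> (y, x) \<in> E"

definition dbl :: "'a \<Rightarrow> 'a \<Rightarrow> bool" where
  "dbl x y \<longleftrightarrow> (x, y) \<in> E \<and> (y, x) \<in> E"

definition mult :: "'a \<Rightarrow> 'a \<Rightarrow> nat" where
  "mult x y = of_bool (adj x y) + of_bool (dbl x y)"

definition wdeg :: "'a set \<Rightarrow> 'a \<Rightarrow> nat" where
  "wdeg V x = (\<Sum>y\<in>V. mult x y)"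

definition narcs :: "'a set \<Rightarrow> nat" where
  "narcs V = card (E \<inter> V \<times> V)"

definition nbrs :: "'a set \<Rightarrow> 'a \<Rightarrow> 'a set" where
  "nbrs V x = {y \<in> V. adj x y}"

definition dnbrs :: "'a set \<Rightarrow> 'a \<Rightarrow> 'a set" where
  "dnbrs V x = {y \<in> V. dbl x y}"

definition has_dbl :: "'a set \<Rightarrow> bool" where
  "has_dbl V \<longleftrightarrow> (\<exists>x\<in>V. \<exists>y\<in>V. dbl x y)"

lemma adj_sym: "adj x y \<longleftrightarrow> adj y x" and dbl_sym: "dbl x y \<longleftrightarrow> dbl y x"
  by (auto simp: adj_def dbl_def)

lemma dbl_imp_adj: "dbl x y \<Longrightarrow> adj x y"
  by (auto simp: adj_def dbl_def)

lemma not_adj_refl [simp]: "\<not> adj x x" and not_dbl_refl [simp]: "\<not> dbl x x"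
  by (auto simp: adj_def dbl_def irrefl)

lemma adj_neq: "adj x y \<Longrightarrow> x \<noteq> y"
  by auto

lemma mult_sym: "mult x y = mult y x"
  by (simp add: mult_def adj_sym[of x] dbl_sym[of x])

lemma mult_refl [simp]: "mult x x = 0"
  by (simp add: mult_def)

lemma mult_le_2: "mult x y \<le> 2"
  by (simp add: mult_def)

lemma mult_le_1: "\<not> dbl x y \<Longrightarrow> mult x y \<le> 1"
  by (simp add: mult_def)

lemma mult_eq_0: "mult x y = 0 \<longleftrightarrow> \<not> adj x y"
  by (auto simp: mult_def dbl_imp_adj)

lemma no_P13: "\<lbrakk>a \<noteq> b; a \<noteq> c; a \<noteq> d; b \<noteq> c; b \<noteq> d; c \<noteq> d\<rbrakk> \<Longrightarrow>
    \<not> ((a, b) \<in> E \<and> (b, c) \<in> E \<and> (c, d) \<in> E \<and> (a, d) \<in> E)"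
  using P13_free[of a b c d] by auto

lemma no_K4:
  assumes "a \<noteq> b" "a \<noteq> c" "a \<noteq> d" "b \<noteq> c" "b \<noteq> d" "c \<noteq> d"
  shows "\<not> (adj a b \<and> adj a c \<and> adj a d \<and> adj b c \<and> adj b d \<and> adj c d)"
proof -
  note ne = assms assms[symmetric]
  note free =
    no_P13[of a b c d, OF ne(1) ne(2) ne(3) ne(4) ne(5) ne(6)]
    no_P13[of a b d c, OF ne(1) ne(3) ne(2) ne(5) ne(4) ne(12)]
    no_P13[of a c b d, OF ne(2) ne(1) ne(3) ne(10) ne(6) ne(5)]
    no_P13[of a c d b, OF ne(2) ne(3) ne(1) ne(6) ne(10) ne(11)]
    no_P13[of a d b c, OF ne(3) ne(1) ne(2) ne(11) ne(12) ne(4)]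
    no_P13[of a d c b, OF ne(3) ne(2) ne(1) ne(12) ne(11) ne(10)]
    no_P13[of b a c d, OF ne(7) ne(4) ne(5) ne(2) ne(3) ne(6)]
    no_P13[of b a d c, OF ne(7) ne(5) ne(4) ne(3) ne(2) ne(12)]
    no_P13[of b c a d, OF ne(4) ne(7) ne(5) ne(8) ne(6) ne(3)]
    no_P13[of b c d a, OF ne(4) ne(5) ne(7) ne(6) ne(8) ne(9)]
    no_P13[of b d a c, OF ne(5) ne(7) ne(4) ne(9) ne(12) ne(2)]
    no_P13[of b d c a, OF ne(5) ne(4) ne(7) ne(12) ne(9) ne(8)]
    no_P13[of c a b d, OF ne(8) ne(10) ne(6) ne(1) ne(3) ne(5)]
    no_P13[of c a d b, OF ne(8) ne(6) ne(10) ne(3) ne(1) ne(11)]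
    no_P13[of c b a d, OF ne(10) ne(8) ne(6) ne(7) ne(5) ne(3)]
    no_P13[of c b d a, OF ne(10) ne(6) ne(8) ne(5) ne(7) ne(9)]
    no_P13[of c d a b, OF ne(6) ne(8) ne(10) ne(9) ne(11) ne(1)]
    no_P13[of c d b a, OF ne(6) ne(10) ne(8) ne(11) ne(9) ne(7)]
    no_P13[of d a b c, OF ne(9) ne(11) ne(12) ne(1) ne(2) ne(4)]
    no_P13[of d a c b, OF ne(9) ne(12) ne(11) ne(2) ne(1) ne(10)]
    no_P13[of d b a c, OF ne(11) ne(9) ne(12) ne(7) ne(4) ne(2)]
    no_P13[of d b c a, OF ne(11) ne(12) ne(9) ne(4) ne(7) ne(8)]
    no_P13[of d c a b, OF ne(12) ne(9) ne(11) ne(8) ne(10) ne(1)]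
    no_P13[of d c b a, OF ne(12) ne(11) ne(9) ne(10) ne(8) ne(7)]
  show ?thesis
    using free unfolding adj_def by sat
qed

lemma dbl_not_in_C4:
  assumes "dbl a b" "adj b c" "adj c d" "adj d a" "a \<noteq> c" "b \<noteq> d"
  shows False
proof -
  have "a \<noteq> b" "a \<noteq> c" "a \<noteq> d" "b \<noteq> c" "b \<noteq> d" "c \<noteq> d"
    using assms by auto
  note ne = this this[symmetric]
  note free =
    no_P13[of a b c d, OF ne(1) ne(2) ne(3) ne(4) ne(5) ne(6)]
    no_P13[of a d c b, OF ne(3) ne(2) ne(1) ne(12) ne(11) ne(10)]
    no_P13[of b c d a, OF ne(4) ne(5) ne(7) ne(6) ne(8) ne(9)]
    no_P13[of b a d c, OF ne(7) ne(5) ne(4) ne(3) ne(2) ne(12)]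
    no_P13[of c d a b, OF ne(6) ne(8) ne(10) ne(9) ne(11) ne(1)]
    no_P13[of c b a d, OF ne(10) ne(8) ne(6) ne(7) ne(5) ne(3)]
    no_P13[of d a b c, OF ne(9) ne(11) ne(12) ne(1) ne(2) ne(4)]
    no_P13[of d c b a, OF ne(12) ne(11) ne(9) ne(10) ne(8) ne(7)]
  show False
    using free assms(1-4) unfolding adj_def dbl_def by sat
qed

lemma wdeg_insert: "\<lbrakk>finite V; y \<notin> V\<rbrakk> \<Longrightarrow> wdeg (insert y V) x = mult x y + wdeg V x"
  by (simp add: wdeg_def)

lemma wdeg_empty [simp]: "wdeg {} x = 0"
  by (simp add: wdeg_def)

lemma wdeg_Un: "\<lbrakk>finite A; finite B; A \<inter> B = {}\<rbrakk> \<Longrightarrow> wdeg (A \<union> B) x = wdeg A x + wdeg B x"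
  by (simp add: wdeg_def sum.union_disjoint)

lemma wdeg_eq: "finite V \<Longrightarrow> wdeg V x = card (nbrs V x) + card (dnbrs V x)"
  by (simp add: wdeg_def mult_def sum.distrib nbrs_def dnbrs_def Collect_conj_eq Int_commute)

lemma narcs_empty [simp]: "narcs {} = 0"
  by (simp add: narcs_def)

lemma narcs_insert:
  assumes "finite V" "x \<notin> V"
  shows "narcs (insert x V) = narcs V + wdeg V x"
proof -
  have "E \<inter> insert x V \<times> insert x V =
    E \<inter> V \<times> V \<union> (Pair x ` {y \<in> V. (x, y) \<in> E} \<union> (\<lambda>y. (y, x)) ` {y \<in> V. (y, x) \<in> E})"
    using irrefl by auto
  also have "card \<dots> = card (E \<inter> V \<times> V) + (card {y \<in> V. (x, y) \<in> E} + card {y \<in> V. (y, x) \<in> E})"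
    using assms by (subst card_Un_disjoint; (subst card_Un_disjoint)?) (auto simp: card_image inj_on_def)
  also have "card {y \<in> V. (x, y) \<in> E} + card {y \<in> V. (y, x) \<in> E} = wdeg V x"
  proof -
    have "card {y \<in> V. P y} = (\<Sum>y\<in>V. of_bool (P y))" for P
      using assms(1) by (simp add: Collect_conj_eq)
    then show ?thesis
      unfolding wdeg_def mult_def adj_def dbl_def by (simp only: sum.distrib[symmetric]) (auto intro!: sum.cong)
  qed
  finally show ?thesis
    by (simp add: narcs_def)
qed

lemma wdeg_remove_self: "finite V \<Longrightarrow> wdeg (V - {x}) x = wdeg V x"
  by (cases "x \<in> V") (simp_all add: wdeg_def sum.remove[of V x])

lemma narcs_remove: "\<lbrakk>finite V; x \<in> V\<rbrakk> \<Longrightarrow> narcs V = narcs (V - {x}) + wdeg V x"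
  using narcs_insert[of "V - {x}" x] by (simp add: insert_absorb wdeg_remove_self)

lemma narcs_Un:
  assumes "finite A" "finite B" "A \<inter> B = {}"
  shows "narcs (A \<union> B) = narcs A + narcs B + (\<Sum>x\<in>A. wdeg B x)"
  using assms
proof (induction A)
  case (insert x A)
  then show ?case
    by (simp add: narcs_insert wdeg_Un)
qed simp

lemma sum_wdeg:
  assumes "finite V"
  shows "(\<Sum>x\<in>V. wdeg V x) = 2 * narcs V"
  using assms
proof (induction V)
  case (insert x V)
  have "(\<Sum>y\<in>insert x V. wdeg (insert x V) y) = wdeg V x + (\<Sum>y\<in>V. mult y x + wdeg V y)"
    using insert by (simp add: wdeg_insert)
  also have "(\<Sum>y\<in>V. mult y x + wdeg V y) = wdeg V x + 2 * narcs V"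
    by (simp add: sum.distrib insert.IH wdeg_def[of V x] mult_sym[of x])
  finally show ?case
    using insert by (simp add: narcs_insert)
qed simp

lemma nbrs_subset: "nbrs V x \<subseteq> V" and dnbrs_subset: "dnbrs V x \<subseteq> nbrs V x"
  by (auto simp: nbrs_def dnbrs_def dbl_imp_adj)

lemma finite_nbrs: "finite V \<Longrightarrow> finite (nbrs V x)"
  by (simp add: nbrs_def)

lemma self_notin_nbrs: "x \<notin> nbrs V x"
  by (auto simp: nbrs_def)

lemma nbrs_disjoint:
  assumes "dbl u v" "adj u w" "v \<noteq> w"
  shows "(nbrs V v - {u}) \<inter> (nbrs V w - {u}) = {}"
  using dbl_not_in_C4[of u v _ w] assms by (auto simp: nbrs_def adj_sym)

section \<open>Minimum weighted degree five\<close>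

lemma wdeg_restrict: "\<lbrakk>finite V; nbrs V x \<subseteq> S; S \<subseteq> V\<rbrakk> \<Longrightarrow> wdeg V x = wdeg S x"
  unfolding wdeg_def by (rule sum.mono_neutral_right) (auto simp: nbrs_def mult_eq_0)

lemma card_dnbrs_le: "finite V \<Longrightarrow> card (dnbrs V x) \<le> card (nbrs V x)"
  by (simp add: card_mono dnbrs_subset finite_nbrs)

lemma card_nbrs_ge_3:
  assumes "finite V" "wdeg V x \<ge> 5"
  shows "card (nbrs V x) \<ge> 3"
  using assms wdeg_eq[of V x] card_dnbrs_le[of V x] by linarith

lemma card_3_subset:
  assumes "S \<subseteq> {a, b, c}" "card S = 3"
  shows "S = {a, b, c}"
proof (rule card_seteq)
  show "card {a, b, c} \<le> card S"
    using assms(2) by (simp add: card_insert_if)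
qed (use assms(1) in auto)

lemma cubic_not_in_C4:
  assumes "finite V" "wdeg V x \<ge> 5" "card (nbrs V x) = 3" "p \<in> nbrs V x" "r \<in> nbrs V x"
    and "p \<noteq> r" "q \<noteq> x" "adj p q" "adj q r"
  shows False
proof -
  have "\<not> dbl x p" "\<not> dbl x r"
    using dbl_not_in_C4[of x p q r] dbl_not_in_C4[of x r q p] assms by (auto simp: nbrs_def adj_sym)
  then have "dnbrs V x \<subseteq> nbrs V x - {p, r}"
    using dnbrs_subset[of V x] by (auto simp: dnbrs_def)
  then have "card (dnbrs V x) \<le> card (nbrs V x - {p, r})"
    using assms(1) by (intro card_mono) (auto simp: finite_nbrs)
  also have "\<dots> = 1"
    using assms by (subst card_Diff_subset) auto
  finally show False
    using wdeg_eq[of V x] assms(1-3) by linarith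
qed

lemma cubic_triangle:
  assumes V: "finite V" "card V \<le> 9" "\<And>x. x \<in> V \<Longrightarrow> wdeg V x \<ge> 5"
    and x: "x \<in> V" "card (nbrs V x) = 3"
  shows "\<exists>a\<in>nbrs V x. \<exists>b\<in>nbrs V x. adj a b"
proof (rule ccontr)
  assume no: "\<not> ?thesis"
  define B where "B y = nbrs V y - {x}" for y
  have fin: "finite (nbrs V y)" "finite (B y)" for y
    using V(1) by (auto simp: B_def finite_nbrs)
  have B: "card (B y) \<ge> 2" if "y \<in> nbrs V x" for y
  proof -
    have "card (nbrs V y) \<ge> 3"
      using that V x by (intro card_nbrs_ge_3) (auto simp: nbrs_def)
    then show ?thesis
      using that x fin by (simp add: B_def nbrs_def adj_sym card_Diff_singleton)
  qed
  have disj: "B y \<inter> B z = {}" if "y \<in> nbrs V x" "z \<in> nbrs V x" "y \<noteq> z" for y z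
    using cubic_not_in_C4[of V x y z] that V x by (auto simp: B_def nbrs_def adj_sym)
  have "6 \<le> (\<Sum>y\<in>nbrs V x. card (B y))"
    using sum_mono[of "nbrs V x" "\<lambda>_. 2" "\<lambda>y. card (B y)"] B x by simp
  also have "\<dots> = card (\<Union>y\<in>nbrs V x. B y)"
    using fin disj by (subst card_UN_disjoint) auto
  finally have "6 \<le> card (\<Union>y\<in>nbrs V x. B y)" .
  moreover have "card (insert x (nbrs V x) \<union> (\<Union>y\<in>nbrs V x. B y)) =
      1 + 3 + card (\<Union>y\<in>nbrs V x. B y)"
  proof -
    have "insert x (nbrs V x) \<inter> (\<Union>y\<in>nbrs V x. B y) = {}"
      using no by (auto simp: B_def nbrs_def)
    then show ?thesis
      using x fin self_notin_nbrs[of x V] by (simp add: card_Un_disjoint)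
  qed
  moreover have "card (insert x (nbrs V x) \<union> (\<Union>y\<in>nbrs V x. B y)) \<le> card V"
    using V x by (intro card_mono) (auto simp: B_def nbrs_def)
  ultimately show False
    using V by linarith
qed

text \<open>
  A vertex \<open>x\<close> with three neighbours has at least two 2-cycles and so lies in no 4-cycle.  Hence the
  neighbourhoods of its neighbours \<open>y1\<close>, \<open>y2\<close>, \<open>y3\<close> are disjoint outside \<open>x\<close>, which almost exhausts nine
  vertices.
\<close>

lemma no_cubic_vertex:
  assumes V: "finite V" "card V \<le> 9" "\<And>x. x \<in> V \<Longrightarrow> wdeg V x \<ge> 5"
    and x: "x \<in> V"
  shows "card (nbrs V x) \<noteq> 3"
proof
  assume x3: "card (nbrs V x) = 3"
  note C4 = cubic_not_in_C4[OF V(1) V(3)]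
  obtain y1 y2 where y12: "y1 \<in> nbrs V x" "y2 \<in> nbrs V x" "adj y1 y2"
    using cubic_triangle[OF V x x3] by blast
  then have "card (nbrs V x - {y1, y2}) = 1"
    using x3 adj_neq[of y1 y2] by (subst card_Diff_subset) auto
  then obtain y3 where y3: "nbrs V x - {y1, y2} = {y3}"
    by (auto simp: card_1_singleton_iff)
  have Nx: "nbrs V x = {y1, y2, y3}" and ne: "y1 \<noteq> y2" "y1 \<noteq> y3" "y2 \<noteq> y3" "x \<noteq> y1" "x \<noteq> y2" "x \<noteq> y3"
  proof -
    show "y1 \<noteq> y2"
      using y12 by auto
    have "y3 \<in> nbrs V x - {y1, y2}"
      by (simp add: y3)
    then show "y1 \<noteq> y3" "y2 \<noteq> y3"
      by auto
    then show "nbrs V x = {y1, y2, y3}"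
      using y3 y12 by blast
    then show "x \<noteq> y1" "x \<noteq> y2" "x \<noteq> y3"
      using self_notin_nbrs[of x V] by auto
  qed
  have yV: "y1 \<in> V" "y2 \<in> V" "y3 \<in> V" and xy: "adj x y1" "adj x y2" "adj x y3"
    using Nx by (auto simp: nbrs_def)
  have y3_12: "\<not> adj y3 y1" "\<not> adj y3 y2"
    using C4[OF x x3, of y3 y2 y1] C4[OF x x3, of y3 y1 y2] Nx ne y12 by (auto simp: adj_sym)
  have share: "\<not> (adj p z \<and> adj q z)" if "p \<in> {y1, y2, y3}" "q \<in> {y1, y2, y3}" "p \<noteq> q" "z \<noteq> x" for p q z
    using C4[OF x x3, of p q z] Nx that by (auto simp: adj_sym)
  define Z1 where "Z1 = nbrs V y1 - {x, y2}"
  define Z2 where "Z2 = nbrs V y2 - {x, y1}"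
  define Z3 where "Z3 = nbrs V y3 - {x}"
  define L where "L = V - ({x, y1, y2, y3} \<union> Z1 \<union> Z2 \<union> Z3)"
  have N1: "nbrs V y1 = insert x (insert y2 Z1)" and N2: "nbrs V y2 = insert x (insert y1 Z2)"
    and N3: "nbrs V y3 = insert x Z3"
    using xy yV x y12 by (auto simp: Z1_def Z2_def Z3_def nbrs_def adj_sym)
  have fin: "finite Z1" "finite Z2" "finite Z3" "finite L"
    using V(1) by (auto simp: Z1_def Z2_def Z3_def L_def finite_nbrs)
  have c1: "card (nbrs V y1) = card Z1 + 2" and c2: "card (nbrs V y2) = card Z2 + 2"
    and c3: "card (nbrs V y3) = card Z3 + 1"
    using fin ne unfolding N1 N2 N3 by (simp_all add: card_insert_if) (simp_all add: Z1_def Z2_def Z3_def)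
  have ge: "card (nbrs V y) \<ge> 3" if "y \<in> V" for y
    using card_nbrs_ge_3[OF V(1) V(3)] that by blast
  have disj: "{x, y1, y2, y3} \<inter> Z1 = {}" "{x, y1, y2, y3} \<inter> Z2 = {}" "{x, y1, y2, y3} \<inter> Z3 = {}"
     "Z1 \<inter> Z2 = {}" "Z1 \<inter> Z3 = {}" "Z2 \<inter> Z3 = {}"
    using y3_12 share[of y1 y2] share[of y1 y3] share[of y2 y3] ne
    by (auto simp: Z1_def Z2_def Z3_def nbrs_def adj_sym)
  have Veq: "V = {x, y1, y2, y3} \<union> Z1 \<union> Z2 \<union> Z3 \<union> L"
    using x yV by (auto simp: Z1_def Z2_def Z3_def L_def nbrs_def)
  have "card V = card ({x, y1, y2, y3} \<union> Z1 \<union> Z2 \<union> Z3) + card L"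
    by (subst Veq, subst card_Un_disjoint) (use fin in \<open>auto simp: L_def\<close>)
  also have "card ({x, y1, y2, y3} \<union> Z1 \<union> Z2 \<union> Z3) = 4 + card Z1 + card Z2 + card Z3"
    using fin disj ne by (simp add: card_Un_disjoint Int_Un_distrib2)
  finally have total: "4 + card Z1 + card Z2 + card Z3 + card L \<le> 9"
    using V(2) by simp
  have Z_ge: "card Z1 \<ge> 1" "card Z2 \<ge> 1" "card Z3 \<ge> 2"
    using ge[OF yV(1)] ge[OF yV(2)] ge[OF yV(3)] c1 c2 c3 by auto
  have adjZ: "adj y1 z \<longleftrightarrow> z \<in> {x, y2} \<union> Z1" "adj y2 z \<longleftrightarrow> z \<in> {x, y1} \<union> Z2"
    "adj y3 z \<longleftrightarrow> z \<in> insert x Z3" "adj x z \<longleftrightarrow> z \<in> {y1, y2, y3}" if "z \<in> V" for z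
    using that N1 N2 N3 Nx by (auto simp: nbrs_def)
  have ZV: "Z1 \<subseteq> V" "Z2 \<subseteq> V" "Z3 \<subseteq> V" "L \<subseteq> V"
    by (auto simp: Z1_def Z2_def Z3_def L_def nbrs_def)
  have Z12: "\<not> adj a b" if "a \<in> Z1" "b \<in> Z2" for a b
  proof
    assume ab: "adj a b"
    have "card Z1 = 1 \<or> card Z2 = 1"
      using total Z_ge by linarith
    then show False
    proof
      assume "card Z1 = 1"
      then show False
        using C4[OF yV(1), of y2 a b] c1 that ab N1 N2 disj y12
        by (auto simp: adj_sym Z2_def nbrs_def)
    next
      assume "card Z2 = 1"
      then show False
        using C4[OF yV(2), of y1 b a] c2 that ab N1 N2 disj y12
        by (auto simp: adj_sym Z1_def nbrs_def)
    qed
  qed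
  obtain z1 z2 where z: "z1 \<in> Z1" "z2 \<in> Z2"
    using Z_ge by (metis all_not_in_conv card.empty not_one_le_zero)
  have zV: "z1 \<in> V" "z2 \<in> V"
    using z ZV by auto
  have Nz1: "nbrs V z1 \<subseteq> {y1} \<union> (Z1 - {z1}) \<union> (nbrs V z1 \<inter> Z3) \<union> L"
  proof -
    have "x \<notin> nbrs V z1" "y2 \<notin> nbrs V z1" "y3 \<notin> nbrs V z1"
      using adjZ[OF zV(1)] disj z adj_sym[of z1] by (auto simp: nbrs_def)
    moreover have "nbrs V z1 \<inter> Z2 = {}"
      using Z12[OF z(1)] adj_sym[of z1] by (auto simp: nbrs_def)
    moreover have "z1 \<notin> nbrs V z1"
      by (rule self_notin_nbrs)
    moreover have "nbrs V z1 \<subseteq> {x, y1, y2, y3} \<union> Z1 \<union> Z2 \<union> Z3 \<union> L"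
      using nbrs_subset[of V z1] Veq by simp
    ultimately show ?thesis
      by blast
  qed
  have Nz2: "nbrs V z2 \<subseteq> {y2} \<union> (Z2 - {z2}) \<union> (nbrs V z2 \<inter> Z3) \<union> L"
  proof -
    have "x \<notin> nbrs V z2" "y1 \<notin> nbrs V z2" "y3 \<notin> nbrs V z2"
      using adjZ[OF zV(2)] disj z adj_sym[of z2] by (auto simp: nbrs_def)
    moreover have "nbrs V z2 \<inter> Z1 = {}"
      using Z12[OF _ z(2)] adj_sym[of z2] by (auto simp: nbrs_def)
    moreover have "z2 \<notin> nbrs V z2"
      by (rule self_notin_nbrs)
    moreover have "nbrs V z2 \<subseteq> {x, y1, y2, y3} \<union> Z1 \<union> Z2 \<union> Z3 \<union> L"
      using nbrs_subset[of V z2] Veq by simp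
    ultimately show ?thesis
      by blast
  qed
  have cz1: "card (nbrs V z1) \<le> card Z1 + card (nbrs V z1 \<inter> Z3) + card L"
  proof -
    have "card (nbrs V z1) \<le> card ({y1} \<union> (Z1 - {z1}) \<union> (nbrs V z1 \<inter> Z3) \<union> L)"
      using Nz1 fin by (intro card_mono) auto
    also have "\<dots> \<le> 1 + card (Z1 - {z1}) + card (nbrs V z1 \<inter> Z3) + card L"
      by (intro order_trans[OF card_Un_le] add_mono) auto
    finally show ?thesis
      using z fin Z_ge by (simp add: card_Diff_singleton)
  qed
  have cz2: "card (nbrs V z2) \<le> card Z2 + card (nbrs V z2 \<inter> Z3) + card L"
  proof -
    have "card (nbrs V z2) \<le> card ({y2} \<union> (Z2 - {z2}) \<union> (nbrs V z2 \<inter> Z3) \<union> L)"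
      using Nz2 fin by (intro card_mono) auto
    also have "\<dots> \<le> 1 + card (Z2 - {z2}) + card (nbrs V z2 \<inter> Z3) + card L"
      by (intro order_trans[OF card_Un_le] add_mono) auto
    finally show ?thesis
      using z fin Z_ge by (simp add: card_Diff_singleton)
  qed
  consider "card Z3 = 2" | "card Z3 \<ge> 3"
    using Z_ge by linarith
  then show False
  proof cases
    case 1
    then have y3_3: "card (nbrs V y3) = 3"
      using c3 by simp
    have le1: "card (nbrs V v \<inter> Z3) \<le> 1" if "v \<in> V" "v \<noteq> y3" for v
    proof (rule ccontr)
      assume "\<not> ?thesis"
      then obtain p q where "p \<in> nbrs V v \<inter> Z3" "q \<in> nbrs V v \<inter> Z3" "p \<noteq> q"
        by (metis card_le_Suc0_iff_eq One_nat_def fin(3) finite_Int)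
      then show False
        using C4[OF yV(3) y3_3, of p q v] that N3 by (auto simp: nbrs_def adj_sym)
    qed
    have ne3: "z1 \<noteq> y3" "z2 \<noteq> y3"
      using z disj by auto
    have "card L = 1" "card Z1 = 1" "card Z2 = 1"
      using cz1 cz2 ge[OF zV(1)] ge[OF zV(2)] le1[OF zV(1) ne3(1)] le1[OF zV(2) ne3(2)] total Z_ge 1
      by linarith+
    then have d3: "card (nbrs V z1) = 3" "card (nbrs V z2) = 3"
      and "card (nbrs V z1 \<inter> Z3) = 1" "card (nbrs V z2 \<inter> Z3) = 1"
      using cz1 cz2 ge[OF zV(1)] ge[OF zV(2)] le1[OF zV(1) ne3(1)] le1[OF zV(2) ne3(2)]
      by linarith+
    moreover obtain l where L: "L = {l}"
      using \<open>card L = 1\<close> by (auto simp: card_1_singleton_iff)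
    ultimately obtain c d where cd: "nbrs V z1 \<inter> Z3 = {c}" "nbrs V z2 \<inter> Z3 = {d}"
      by (metis card_1_singletonE)
    have Z1: "Z1 = {z1}" "Z2 = {z2}"
      using \<open>card Z1 = 1\<close> \<open>card Z2 = 1\<close> z by (auto simp: card_1_singleton_iff)
    have Nz: "nbrs V z1 = {y1, c, l}" "nbrs V z2 = {y2, d, l}"
    proof -
      show "nbrs V z1 = {y1, c, l}"
        by (rule card_3_subset) (use Nz1[unfolded cd L Z1] d3 in auto)
      show "nbrs V z2 = {y2, d, l}"
        by (rule card_3_subset) (use Nz2[unfolded cd L Z1] d3 in auto)
    qed
    have cdZ: "c \<in> Z3" "d \<in> Z3" and lL: "l \<in> L"
      using cd L by blast+
    then have cdV: "c \<in> V" "d \<in> V" "l \<in> V"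
      using ZV by blast+
    have "\<not> adj y1 c" "\<not> adj x c"
      using adjZ[OF cdV(1)] cdZ(1) disj by auto
    moreover have "\<not> adj y2 d" "\<not> adj x d"
      using adjZ[OF cdV(2)] cdZ(2) disj by auto
    moreover have "\<not> adj y1 l" "\<not> adj y2 l"
      using adjZ[OF cdV(3)] lL by (auto simp: L_def)
    ultimately have nadj: "\<not> adj y1 c" "\<not> adj x c" "\<not> adj y2 d" "\<not> adj x d" "\<not> adj y1 l" "\<not> adj y2 l"
      by blast+
    then have cl: "adj c l" "adj d l"
      using cubic_triangle[OF V zV(1) d3(1)] cubic_triangle[OF V zV(2) d3(2)] Nz nadj
      by (auto simp: adj_sym)
    have "z1 \<noteq> z2" "z1 \<noteq> d" "c \<noteq> l" "d \<noteq> l"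
      using z disj cdZ lL by (auto simp: L_def)
    moreover have "adj z2 d" "adj z2 l"
      using Nz(2) by (auto simp: nbrs_def)
    ultimately have "c \<noteq> d"
      using C4[OF zV(1) d3(1), of c l z2] Nz(1) adj_sym by blast
    then have Z3: "Z3 = {c, d}"
      using 1 cdZ card_seteq[of Z3 "{c, d}"] fin by auto
    then have "adj c d"
      using cubic_triangle[OF V yV(3) y3_3] N3 nadj by (auto simp: adj_sym)
    then show False
      using C4[OF zV(1) d3(1), of c l d] cl Nz(1) \<open>c \<noteq> l\<close> \<open>z1 \<noteq> d\<close> by simp
  next
    case 2
    then have c: "card Z3 = 3" "card Z1 = 1" "card Z2 = 1" "card L = 0"
      using total Z_ge by linarith+
    then have Z: "Z1 = {z1}" "Z2 = {z2}" "L = {}"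
      using z fin by (auto simp: card_1_singleton_iff)
    have all: "Z3 \<subseteq> nbrs V v" if v: "v \<in> V" "v \<noteq> y3" "card (nbrs V v) \<le> 1 + card (nbrs V v \<inter> Z3)" for v
    proof -
      have "card (nbrs V v \<inter> Z3) \<ge> 2"
        using ge[OF v(1)] v by linarith
      then obtain p q where "p \<in> nbrs V v \<inter> Z3" "q \<in> nbrs V v \<inter> Z3" "p \<noteq> q"
        by (metis card_le_Suc0_iff_eq One_nat_def fin(3) finite_Int not_less_eq_eq numeral_2_eq_2)
      then have "card (nbrs V v) \<noteq> 3"
        using C4[OF v(1), of p q y3] v N3 by (auto simp: nbrs_def adj_sym)
      then have "card (nbrs V v \<inter> Z3) \<ge> card Z3"
        using ge[OF v(1)] v c by linarith
      then show ?thesis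
        using card_seteq[of Z3 "nbrs V v \<inter> Z3"] fin by auto
    qed
    have Zz: "Z3 \<subseteq> nbrs V z1" "Z3 \<subseteq> nbrs V z2"
      using all[OF zV(1)] all[OF zV(2)] cz1 cz2 c z disj by auto
    have z12: "z1 \<noteq> z2" "z1 \<noteq> y3" "z2 \<noteq> y3"
      using z disj by auto
    have hub: "\<not> dbl a v" if "a \<in> Z3" "v \<in> {y3, z1, z2}" for a v
    proof
      assume dbl: "dbl a v"
      have "card (Z3 - {a}) = 2"
        using c(1) that by (simp add: card_Diff_singleton)
      then have "Z3 - {a} \<noteq> {}"
        by (metis card.empty zero_neq_numeral)
      then obtain b where b: "b \<in> Z3" "b \<noteq> a"
        by blast
      obtain v' where v': "v' \<in> {y3, z1, z2}" "v' \<noteq> v"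
        using z12 by blast
      have "adj s t" if "s \<in> {y3, z1, z2}" "t \<in> Z3" for s t
        using Zz N3 that by (auto simp: nbrs_def)
      then show False
        using dbl_not_in_C4[OF dbl, of b v'] that b v' adj_sym by metis
    qed
    have le3: "2 \<le> wdeg (Z3 - {a}) a" if a: "a \<in> Z3" for a
    proof -
      have aV: "a \<in> V" using a ZV by auto
      have "nbrs V a \<subseteq> {y3, z1, z2} \<union> (Z3 - {a})"
        using adjZ[OF aV] a disj Veq Z by (auto simp: nbrs_def adj_sym)
      then have "wdeg V a = wdeg ({y3, z1, z2} \<union> (Z3 - {a})) a"
        using V(1) yV zV ZV by (intro wdeg_restrict) auto
      also have "\<dots> = wdeg {y3, z1, z2} a + wdeg (Z3 - {a}) a"
        using fin disj z by (intro wdeg_Un) auto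
      also have "wdeg {y3, z1, z2} a \<le> 3"
        using mult_le_1[OF hub[OF a, of y3]] mult_le_1[OF hub[OF a, of z1]] mult_le_1[OF hub[OF a, of z2]] z12
        by (simp add: wdeg_def)
      finally show ?thesis
        using V(3)[OF aV] by linarith
    qed
    obtain a b d where abd: "Z3 = {a, b, d}" "a \<noteq> b" "a \<noteq> d" "b \<noteq> d"
      using c(1) by (auto simp: card_3_iff)
    have y3a: "adj y3 a" "adj y3 b" "adj y3 d" "y3 \<notin> {a, b, d}"
      using N3 disj abd by (auto simp: nbrs_def)
    have "Z3 - {a} = {b, d}" "Z3 - {b} = {a, d}" "Z3 - {d} = {a, b}"
      using abd by auto
    then have m: "2 \<le> mult a b + mult a d" "2 \<le> mult a b + mult b d" "2 \<le> mult a d + mult b d"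
      using le3[of a] le3[of b] le3[of d] abd by (auto simp: wdeg_def mult_sym)
    have "\<not> (adj a b \<and> adj a d \<and> adj b d)"
      using no_K4[of y3 a b d] abd y3a by auto
    moreover have "\<not> (dbl p q \<and> adj p r)" if "p \<in> {a, b, d}" "q \<in> {a, b, d}" "r \<in> {a, b, d}" "q \<noteq> r" for p q r
      using dbl_not_in_C4[of q p r y3] that y3a by (auto simp: adj_sym dbl_sym)
    from this[of a b d] this[of a d b] this[of b a d] this[of b d a] this[of d a b] this[of d b a]
    have "\<not> (dbl a b \<and> adj a d)" "\<not> (dbl a d \<and> adj a b)" "\<not> (dbl a b \<and> adj b d)"
      "\<not> (dbl b d \<and> adj a b)" "\<not> (dbl a d \<and> adj b d)" "\<not> (dbl b d \<and> adj a d)"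
      using abd by (simp_all add: adj_sym dbl_sym)
    ultimately show False
      using m by (simp add: mult_def of_bool_def dbl_imp_adj split: if_splits)
  qed
qed

lemma narcs_3: "\<lbrakk>a \<noteq> b; a \<noteq> c; b \<noteq> c\<rbrakk> \<Longrightarrow> narcs {a, b, c} = mult a b + mult a c + mult b c"
  by (simp add: narcs_insert wdeg_insert)

lemma narcs_4:
  "\<lbrakk>a \<noteq> b; a \<noteq> c; a \<noteq> d; b \<noteq> c; b \<noteq> d; c \<noteq> d\<rbrakk> \<Longrightarrow>
    narcs {a, b, c, d} = mult a b + mult a c + mult a d + mult b c + mult b d + mult c d"
  by (simp add: narcs_insert wdeg_insert)

lemma card_4_obtain:
  assumes "card S = 4"
  obtains a b c d where "S = {a, b, c, d}" "a \<noteq> b" "a \<noteq> c" "a \<noteq> d" "b \<noteq> c" "b \<noteq> d" "c \<noteq> d"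
  using assms by (auto simp: eval_nat_numeral card_Suc_eq)

lemma matching_bound:
  fixes s1 s2 s3 t1 t2 t3 :: nat
  assumes "s1 \<le> 2" "s2 \<le> 2" "s3 \<le> 2" "t1 \<le> s1" "t2 \<le> s2" "t3 \<le> s3"
    and "\<not> (s1 = 2 \<and> s2 = 2 \<and> s3 = 2)"
    and "s1 = 2 \<Longrightarrow> s2 = 2 \<Longrightarrow> t1 = 0 \<and> t2 = 0"
    and "s1 = 2 \<Longrightarrow> s3 = 2 \<Longrightarrow> t1 = 0 \<and> t3 = 0"
    and "s2 = 2 \<Longrightarrow> s3 = 2 \<Longrightarrow> t2 = 0 \<and> t3 = 0"
    and "t1 = 0 \<and> t2 = 0 \<or> t1 = 0 \<and> t3 = 0 \<or> t2 = 0 \<and> t3 = 0"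
  shows "s1 + s2 + s3 + t1 + t2 + t3 \<le> 6"
  using assms by (cases "s1 = 2"; cases "s2 = 2"; cases "s3 = 2"; auto)

text \<open>The six pairs are grouped into the three perfect matchings; a 4-cycle is the union of two of them.\<close>

lemma narcs_4_matchings:
  assumes ne: "a \<noteq> b" "a \<noteq> c" "a \<noteq> d" "b \<noteq> c" "b \<noteq> d" "c \<noteq> d"
  defines "s1 \<equiv> of_bool (adj a b) + of_bool (adj c d) :: nat"
    and "s2 \<equiv> of_bool (adj a c) + of_bool (adj b d) :: nat"
    and "s3 \<equiv> of_bool (adj a d) + of_bool (adj b c) :: nat"
    and "t1 \<equiv> of_bool (dbl a b) + of_bool (dbl c d) :: nat"
    and "t2 \<equiv> of_bool (dbl a c) + of_bool (dbl b d) :: nat"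
    and "t3 \<equiv> of_bool (dbl a d) + of_bool (dbl b c) :: nat"
  shows "narcs {a, b, c, d} = s1 + s2 + s3 + t1 + t2 + t3"
    and "s1 \<le> 2" "s2 \<le> 2" "s3 \<le> 2" "t1 \<le> s1" "t2 \<le> s2" "t3 \<le> s3"
    and "\<not> (s1 = 2 \<and> s2 = 2 \<and> s3 = 2)"
    and "s1 = 2 \<Longrightarrow> s2 = 2 \<Longrightarrow> t1 = 0 \<and> t2 = 0"
    and "s1 = 2 \<Longrightarrow> s3 = 2 \<Longrightarrow> t1 = 0 \<and> t3 = 0"
    and "s2 = 2 \<Longrightarrow> s3 = 2 \<Longrightarrow> t2 = 0 \<and> t3 = 0"
proof -
  have *: "\<not> dbl a b \<and> \<not> dbl b c \<and> \<not> dbl c d \<and> \<not> dbl a d"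
    if "a \<noteq> c" "b \<noteq> d" "adj a b" "adj b c" "adj c d" "adj a d" for a b c d
    using that dbl_not_in_C4[of a b c d] dbl_not_in_C4[of b c d a] dbl_not_in_C4[of c d a b]
      dbl_not_in_C4[of a d c b] by (metis adj_sym)
  have two: "of_bool p + of_bool q = (2 :: nat) \<longleftrightarrow> p \<and> q" for p q
    by simp
  show "narcs {a, b, c, d} = s1 + s2 + s3 + t1 + t2 + t3"
    using ne by (simp add: narcs_insert wdeg_insert mult_def s1_def s2_def s3_def t1_def t2_def t3_def)
  show "s1 \<le> 2" "s2 \<le> 2" "s3 \<le> 2"
    by (simp_all add: s1_def s2_def s3_def)
  show "t1 \<le> s1" "t2 \<le> s2" "t3 \<le> s3"
    unfolding s1_def s2_def s3_def t1_def t2_def t3_def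
    by (intro add_mono; simp add: dbl_imp_adj)+
  show "\<not> (s1 = 2 \<and> s2 = 2 \<and> s3 = 2)"
    using no_K4[OF ne] unfolding s1_def s2_def s3_def two by blast
  show "t1 = 0 \<and> t2 = 0" if "s1 = 2" "s2 = 2"
    using that *[of a d b c] ne unfolding s1_def s2_def t1_def t2_def two by (simp add: adj_sym dbl_sym)
  show "t1 = 0 \<and> t3 = 0" if "s1 = 2" "s3 = 2"
    using that *[of a c b d] ne unfolding s1_def s3_def t1_def t3_def two by (simp add: adj_sym dbl_sym)
  show "t2 = 0 \<and> t3 = 0" if "s2 = 2" "s3 = 2"
    using that *[of a b c d] ne unfolding s2_def s3_def t2_def t3_def two by (simp add: adj_sym dbl_sym)
qed

lemma narcs_4_le_6:
  assumes "card S = 4" "\<And>x y z. \<lbrakk>x \<in> S; y \<in> S; z \<in> S; dbl x y; dbl x z\<rbrakk> \<Longrightarrow> y = z"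
  shows "narcs S \<le> 6"
proof -
  obtain a b c d where S: "S = {a, b, c, d}" and ne: "a \<noteq> b" "a \<noteq> c" "a \<noteq> d" "b \<noteq> c" "b \<noteq> d" "c \<noteq> d"
    using card_4_obtain[OF assms(1)] by metis
  have "\<not> (dbl a b \<and> dbl a c)" "\<not> (dbl a b \<and> dbl a d)" "\<not> (dbl a c \<and> dbl a d)"
    "\<not> (dbl a b \<and> dbl b c)" "\<not> (dbl a b \<and> dbl b d)" "\<not> (dbl b c \<and> dbl b d)"
    "\<not> (dbl a c \<and> dbl b c)" "\<not> (dbl a c \<and> dbl c d)" "\<not> (dbl b c \<and> dbl c d)"
    "\<not> (dbl a d \<and> dbl b d)" "\<not> (dbl a d \<and> dbl c d)" "\<not> (dbl b d \<and> dbl c d)"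
    using assms(2) ne dbl_sym unfolding S by (metis insertCI)+
  then have zero: "of_bool (dbl a b) + of_bool (dbl c d) = (0 :: nat) \<and> of_bool (dbl a c) + of_bool (dbl b d) = (0 :: nat) \<or>
    of_bool (dbl a b) + of_bool (dbl c d) = (0 :: nat) \<and> of_bool (dbl a d) + of_bool (dbl b c) = (0 :: nat) \<or>
    of_bool (dbl a c) + of_bool (dbl b d) = (0 :: nat) \<and> of_bool (dbl a d) + of_bool (dbl b c) = (0 :: nat)"
    by (cases "dbl a b"; cases "dbl c d"; cases "dbl a c"; cases "dbl b d"; simp)
  show ?thesis
    unfolding S narcs_4_matchings(1)[OF ne]
    by (rule matching_bound) (fact narcs_4_matchings(2-11)[OF ne] zero)+
qed

lemma unique_dnbr:
  assumes V: "finite V" "card V \<le> 9" "\<And>x. x \<in> V \<Longrightarrow> card (nbrs V x) \<ge> 4"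
    and "u \<in> V" "v1 \<in> V" "v2 \<in> V" "dbl u v1" "dbl u v2"
  shows "v1 = v2"
proof (rule ccontr)
  assume "v1 \<noteq> v2"
  have "\<not> nbrs V u \<subseteq> {v1, v2}"
  proof
    assume "nbrs V u \<subseteq> {v1, v2}"
    then have "card (nbrs V u) \<le> card {v1, v2}"
      by (intro card_mono) auto
    then show False
      using V(3)[OF \<open>u \<in> V\<close>] \<open>v1 \<noteq> v2\<close> by simp
  qed
  then obtain w where w: "w \<in> V" "adj u w" "w \<noteq> v1" "w \<noteq> v2"
    by (auto simp: nbrs_def)
  define B where "B y = nbrs V y - {u}" for y
  have fin: "finite (B y)" for y
    using V(1) by (simp add: B_def finite_nbrs)
  have B: "card (B y) \<ge> 3" if "y \<in> V" for y
  proof -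
    have "card (B y) \<ge> card (nbrs V y) - 1"
      using V(1) by (simp add: B_def card_Diff_singleton_if finite_nbrs)
    then show ?thesis
      using V(3)[OF that] by linarith
  qed
  have "card (B v1 \<union> B v2 \<union> B w) = card (B v1) + card (B v2) + card (B w)"
    using nbrs_disjoint[of u v1 v2 V] nbrs_disjoint[of u v1 w V] nbrs_disjoint[of u v2 w V] assms w \<open>v1 \<noteq> v2\<close>
    by (subst card_Un_disjoint | simp add: B_def[symmetric] fin dbl_imp_adj Int_Un_distrib2)+
  moreover have "card (B v1 \<union> B v2 \<union> B w) \<le> card (V - {u})"
    using V(1) by (intro card_mono) (auto simp: B_def nbrs_def)
  moreover have "card (V - {u}) \<le> 8"
    using V assms by (simp add: card_Diff_singleton)
  ultimately show False
    using B[of v1] B[of v2] B[of w] assms w by linarith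
qed

lemma card_ge_2_obtain:
  assumes "card S \<ge> 2"
  obtains x y where "x \<in> S" "y \<in> S" "x \<noteq> y"
proof -
  obtain T where "T \<subseteq> S" "card T = 2"
    using obtain_subset_with_card_n[OF assms] by blast
  then obtain x y where "x \<in> T" "y \<in> T" "x \<noteq> y"
    by (auto simp: card_2_iff)
  then show ?thesis
    using that \<open>T \<subseteq> S\<close> by blast
qed

lemma wdeg_4_dbl:
  assumes "finite V" "card (nbrs V x) \<le> 4" "wdeg V x \<ge> 5"
  obtains z where "z \<in> V" "dbl x z"
proof -
  have "card (dnbrs V x) \<ge> 1"
    using wdeg_eq[of V x] assms by linarith
  then have "dnbrs V x \<noteq> {}"
    by auto
  then show ?thesis
    using that by (auto simp: dnbrs_def)
qed

end

text \<open>
  The 2-cycle \<open>u v\<close> lies in no 4-cycle, so there is no edge between the outer neighbourhoods \<open>P\<close> of \<open>u\<close>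
  and \<open>A\<close> of \<open>v\<close>.  Counting then forces \<open>P = A\<close>, an independent set, and leaves three or four
  further vertices \<open>R\<close>.
\<close>

locale dense_dbl = P13_free +
  fixes V and u v
  assumes fin: "finite V" and card_le: "card V \<le> 9"
    and wdeg_ge: "\<And>x. x \<in> V \<Longrightarrow> wdeg V x \<ge> 5"
    and card_nbrs: "\<And>x. x \<in> V \<Longrightarrow> card (nbrs V x) \<ge> 4"
    and uv: "u \<in> V" "v \<in> V" "dbl u v"
begin

definition "P = nbrs V u - {v}"
definition "A = nbrs V v - {u}"
definition "R = V - ({u, v} \<union> P \<union> A)"

lemma swap: "dense_dbl E V v u"
  using uv dbl_sym by unfold_locales (auto simp: fin card_le wdeg_ge card_nbrs)

lemma swap_sets: "dense_dbl.P E V v u = A" "dense_dbl.A E V v u = P" "dense_dbl.R E V v u = R"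
proof -
  interpret sw: dense_dbl E V v u
    by (rule swap)
  show "sw.P = A" "sw.A = P"
    by (simp_all add: sw.P_def sw.A_def P_def A_def)
  then show "sw.R = R"
    by (auto simp: sw.R_def R_def)
qed

lemma u_neq_v: "u \<noteq> v"
  using uv by auto

lemma finite_sets: "finite P" "finite A" "finite R"
  using fin by (auto simp: P_def A_def R_def finite_nbrs)

lemma nbrs_u: "nbrs V u = insert v P" and nbrs_v: "nbrs V v = insert u A"
  using uv adj_sym dbl_imp_adj by (auto simp: P_def A_def nbrs_def)

lemma notin: "u \<notin> P" "v \<notin> P" "u \<notin> A" "v \<notin> A" "u \<notin> R" "v \<notin> R"
  by (auto simp: P_def A_def R_def nbrs_def)

lemma R_disjoint: "R \<inter> P = {}" "R \<inter> A = {}"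
  by (auto simp: R_def)

lemma subsets: "P \<subseteq> V" "A \<subseteq> V" "R \<subseteq> V"
  by (auto simp: P_def A_def R_def nbrs_def)

lemma V_eq: "V = {u, v} \<union> (P \<union> A) \<union> R"
  using subsets uv by (auto simp: R_def)

lemma adj_P: "x \<in> P \<Longrightarrow> adj u x" "x \<in> P \<Longrightarrow> adj x u" and adj_A: "x \<in> A \<Longrightarrow> adj v x" "x \<in> A \<Longrightarrow> adj x v"
  by (auto simp: P_def A_def nbrs_def adj_sym)

lemma card_P: "card P \<ge> 3" and card_A: "card A \<ge> 3"
  using card_nbrs[OF uv(1)] card_nbrs[OF uv(2)] finite_sets notin by (simp_all add: nbrs_u nbrs_v)

lemma card_sum: "card (P \<union> A) + card R \<le> 7"
proof -
  have "card V = card {u, v} + card (P \<union> A) + card R"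
  proof -
    have "card V = card ({u, v} \<union> (P \<union> A)) + card R"
      using finite_sets notin R_disjoint by (subst V_eq, intro card_Un_disjoint) auto
    also have "card ({u, v} \<union> (P \<union> A)) = card {u, v} + card (P \<union> A)"
      using finite_sets notin by (intro card_Un_disjoint) auto
    finally show ?thesis .
  qed
  then show ?thesis
    using card_le u_neq_v by simp
qed

lemma R_nonadj:
  assumes "z \<in> R"
  shows "\<not> adj u z" "\<not> adj v z" "\<not> adj z u" "\<not> adj z v"
proof -
  show "\<not> adj u z" "\<not> adj v z"
    using assms subsets by (auto simp: R_def P_def A_def nbrs_def)
  then show "\<not> adj z u" "\<not> adj z v"
    using adj_sym by blast+
qed

lemma P_A_nonadj: "\<lbrakk>x \<in> P; y \<in> A\<rbrakk> \<Longrightarrow> \<not> adj x y"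
  using dbl_not_in_C4[OF uv(3), of y x] adj_P adj_A notin adj_sym by blast

lemma unique: "\<lbrakk>x \<in> V; y \<in> V; z \<in> V; dbl x y; dbl x z\<rbrakk> \<Longrightarrow> y = z"
  using unique_dnbr[OF fin card_le card_nbrs] .

lemma nbrs_common: "c \<in> P \<inter> A \<Longrightarrow> nbrs V c \<subseteq> {u, v} \<union> R"
  using P_A_nonadj V_eq adj_sym unfolding nbrs_def by blast

lemma nbrs_P_only:
  assumes "x \<in> P - A"
  shows "nbrs V x \<subseteq> {u} \<union> (P - A - {x}) \<union> R"
proof
  fix y assume "y \<in> nbrs V x"
  then have y: "y \<in> V" "adj x y" "y \<noteq> x"
    by (auto simp: nbrs_def)
  have "x \<notin> nbrs V v"
    using assms notin by (auto simp: nbrs_v)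
  then have "y \<noteq> v"
    using y assms subsets adj_sym by (auto simp: nbrs_def)
  then show "y \<in> {u} \<union> (P - A - {x}) \<union> R"
    using y V_eq P_A_nonadj assms by blast
qed

lemma card_R_common:
  assumes "c \<in> P \<inter> A"
  shows "card R \<ge> 2"
proof -
  have "card (nbrs V c) \<le> card ({u, v} \<union> R)"
    using nbrs_common[OF assms] finite_sets by (intro card_mono) auto
  also have "\<dots> \<le> 2 + card R"
    using card_Un_le[of "{u, v}" R] u_neq_v by simp
  finally show ?thesis
    using card_nbrs[of c] assms subsets by auto
qed

lemma no_common_card:
  assumes "P \<inter> A = {}"
  shows "card P \<noteq> 3"
proof
  assume P3: "card P = 3"
  have PA: "card (P \<union> A) = card P + card A"
    using assms finite_sets by (simp add: card_Un_disjoint)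
  have R1: "card R \<le> 1"
    using card_sum PA P3 card_A by linarith
  have nb: "nbrs V x = {u} \<union> (P - {x}) \<union> R" if "x \<in> P" for x
  proof (rule card_seteq)
    show "nbrs V x \<subseteq> {u} \<union> (P - {x}) \<union> R"
      using nbrs_P_only[of x] that assms by blast
    have "card ({u} \<union> (P - {x}) \<union> R) \<le> card {u} + card (P - {x}) + card R"
      by (intro order_trans[OF card_Un_le] add_mono) auto
    also have "\<dots> \<le> 4"
      using R1 P3 that finite_sets by simp
    finally show "card ({u} \<union> (P - {x}) \<union> R) \<le> card (nbrs V x)"
      using card_nbrs[of x] that subsets(1) by (meson order_trans subsetD)
  qed (use finite_sets in auto)
  obtain a b c where abc: "P = {a, b, c}" "a \<noteq> b" "a \<noteq> c" "b \<noteq> c"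
    using P3 by (auto simp: card_3_iff)
  then have "adj a b" "adj a c" "adj b c"
    using nb[of a] nb[of b] by (auto simp: nbrs_def)
  then show False
    using no_K4[of u a b c] adj_P abc notin by auto
qed

lemma common_nonempty: "P \<inter> A \<noteq> {}"
proof
  assume PA: "P \<inter> A = {}"
  interpret sw: dense_dbl E V v u
    by (rule swap)
  have "card A \<noteq> 3"
    using sw.no_common_card PA by (simp add: swap_sets Int_commute)
  moreover have "card P + card A \<le> 7"
    using card_sum PA finite_sets by (simp add: card_Un_disjoint)
  ultimately show False
    using no_common_card[OF PA] card_P card_A by linarith
qed

lemma P_subset_A: "P \<subseteq> A"
proof
  fix x assume "x \<in> P"
  show "x \<in> A"
  proof (rule ccontr)
    assume "x \<notin> A"
    with \<open>x \<in> P\<close> have x: "x \<in> P - A" "x \<in> V"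
      using subsets by auto
    obtain c where c: "c \<in> P \<inter> A"
      using common_nonempty by blast
    have cV: "c \<in> V" "c \<noteq> x"
      using c x subsets by auto
    have PA: "card (P - A) + card A = card (P \<union> A)"
      using finite_sets by (metis Diff_disjoint Un_Diff_cancel2 card_Un_disjoint finite_Diff inf_commute)
    have "card ((P - A) - {x}) = card (P - A) - 1"
      using x finite_sets by simp
    moreover have "card (P - A) \<ge> 1"
      using x finite_sets by (metis card_0_eq empty_iff finite_Diff less_one linorder_not_le)
    ultimately have "card ({u} \<union> (P - A - {x}) \<union> R) \<le> card (P - A) + card R"
      using card_Un_le[of "{u} \<union> (P - A - {x})" R] card_Un_le[of "{u}" "P - A - {x}"] by simp
    also have "\<dots> \<le> 4"
      using PA card_sum card_A by linarith
    finally have "nbrs V x = {u} \<union> (P - A - {x}) \<union> R" and nx4: "card (nbrs V x) \<le> 4"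
      using nbrs_P_only[OF x(1)] card_nbrs[OF x(2)] finite_sets card_seteq[of "{u} \<union> (P - A - {x}) \<union> R" "nbrs V x"]
      by auto
    then have xR: "adj x z" if "z \<in> R" for z
      using that by (auto simp: nbrs_def)
    have not_dbl: "\<not> dbl c z" if "z \<in> R" for z
      using dbl_not_in_C4[of c z x u] xR[OF that] that c cV x adj_P notin adj_sym by blast
    have "card R \<noteq> 2"
    proof
      assume R2: "card R = 2"
      have "card (nbrs V c) \<le> card ({u, v} \<union> R)"
        using nbrs_common[OF c] finite_sets by (intro card_mono) auto
      also have "\<dots> \<le> 4"
        using card_Un_le[of "{u, v}" R] u_neq_v R2 by simp
      finally obtain z where z: "z \<in> V" "dbl c z"
        using wdeg_4_dbl[OF fin _ wdeg_ge[OF cV(1)]] by blast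
      then have "z \<in> {u, v} \<union> R"
        using nbrs_common[OF c] dbl_imp_adj by (auto simp: nbrs_def)
      moreover have "z \<noteq> u" "z \<noteq> v"
        using unique[of u v c] unique[of v u c] z uv cV c notin dbl_sym by blast+
      ultimately show False
        using not_dbl z by blast
    qed
    moreover have "card (P \<union> A) \<ge> 4"
      using PA card_A \<open>card (P - A) \<ge> 1\<close> by linarith
    ultimately have R3: "card R = 3" "card (P - A) = 1"
      using card_R_common[OF c] card_sum PA card_A \<open>card (P - A) \<ge> 1\<close> by linarith+
    then have "P - A = {x}"
      using x by (metis card_1_singletonE singletonD)
    then have nbx: "nbrs V x \<subseteq> {u} \<union> R"
      using nbrs_P_only[OF x(1)] by auto
    obtain z where z: "z \<in> V" "dbl x z"
      using wdeg_4_dbl[OF fin nx4 wdeg_ge[OF x(2)]] by blast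
    moreover have "z \<noteq> u"
      using unique[of u v x] z uv x notin dbl_sym by blast
    ultimately have zR: "z \<in> R"
      using nbx dbl_imp_adj by (auto simp: nbrs_def)
    have "\<not> adj c z"
      using dbl_not_in_C4[of x z c u] z zR c cV x adj_P notin adj_sym by blast
    then have nc: "nbrs V c \<subseteq> {u, v} \<union> (R - {z})"
      using nbrs_common[OF c] by (auto simp: nbrs_def)
    then have "card (nbrs V c) \<le> card ({u, v} \<union> (R - {z}))"
      using finite_sets by (intro card_mono) auto
    also have "\<dots> \<le> 4"
      using card_Un_le[of "{u, v}" "R - {z}"] u_neq_v R3 zR by simp
    finally obtain z' where z': "z' \<in> V" "dbl c z'"
      using wdeg_4_dbl[OF fin _ wdeg_ge[OF cV(1)]] by blast
    moreover have "z' \<noteq> u" "z' \<noteq> v"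
      using unique[of u v c] unique[of v u c] z' uv cV c notin dbl_sym by blast+
    ultimately show False
      using nbrs_common[OF c] dbl_imp_adj not_dbl by (auto simp: nbrs_def)
  qed
qed

lemma P_eq_A: "P = A"
proof -
  interpret sw: dense_dbl E V v u
    by (rule swap)
  show ?thesis
    using P_subset_A sw.P_subset_A by (simp add: swap_sets)
qed


lemma nbrs_P: "c \<in> P \<Longrightarrow> nbrs V c \<subseteq> {u, v} \<union> R"
  using nbrs_common[of c] P_eq_A by simp

lemma card_R: "3 \<le> card R" "card R \<le> 4" "card R = 4 \<Longrightarrow> card P = 3"
proof -
  have sum: "card P + card R \<le> 7"
    using card_sum P_eq_A by simp
  then show "card R \<le> 4" "card R = 4 \<Longrightarrow> card P = 3"
    using card_P by linarith+
  obtain c c' where c: "c \<in> P" "c' \<in> P" "c \<noteq> c'"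
    using card_P card_ge_2_obtain[of P] by auto
  have "card R \<ge> 2"
    using card_R_common[of c] c P_eq_A by simp
  moreover have "card R \<noteq> 2"
  proof
    assume R2: "card R = 2"
    then have le4: "card ({u, v} \<union> R) \<le> 4"
      using card_Un_le[of "{u, v}" R] u_neq_v by simp
    have nb: "nbrs V d = {u, v} \<union> R" if "d \<in> P" for d
      using nbrs_P[OF that] card_nbrs[of d] that subsets le4 finite_sets
      by (intro card_seteq) (auto intro: order_trans)
    obtain z where z: "z \<in> V" "dbl c z"
      using wdeg_4_dbl[OF fin, of c] nb[OF c(1)] le4 wdeg_ge[of c] c subsets by auto
    obtain z' where "z' \<in> R" "z' \<noteq> z"
      using R2 by (metis card_2_iff insertCI)
    then have "adj c' z" "adj c z'" "adj c' z'"
      using nb[OF c(1)] nb[OF c(2)] z dbl_imp_adj by (auto simp: nbrs_def)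
    then show False
      using dbl_not_in_C4[OF z(2), of c' z'] c \<open>z' \<noteq> z\<close> adj_sym by blast
  qed
  ultimately show "3 \<le> card R"
    by simp
qed

lemma no_dbl_P_R:
  assumes c: "c \<in> P" and z: "z \<in> R"
  shows "\<not> dbl c z"
proof
  assume dbl: "dbl c z"
  have cV: "c \<in> V" and zV: "z \<in> V"
    using c z subsets by auto
  have other: "\<not> adj d z" if "d \<in> P" "d \<noteq> c" for d
    using dbl_not_in_C4[OF dbl, of d u] that c z adj_P adj_sym notin by blast
  consider "card R = 3" | "card R = 4"
    using card_R by linarith
  then show False
  proof cases
    case 1
    have nb: "nbrs V d = {u, v} \<union> (R - {z})" if d: "d \<in> P" "d \<noteq> c" for d
    proof (rule card_seteq)
      show "nbrs V d \<subseteq> {u, v} \<union> (R - {z})"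
        using nbrs_P[OF d(1)] other[OF d] by (auto simp: nbrs_def)
      have "card ({u, v} \<union> (R - {z})) \<le> 4"
        using card_Un_le[of "{u, v}" "R - {z}"] u_neq_v 1 z by simp
      then show "card ({u, v} \<union> (R - {z})) \<le> card (nbrs V d)"
        using card_nbrs[of d] d(1) subsets(1) by (meson order_trans subsetD)
    qed (use finite_sets in auto)
    have "card (P - {c}) \<ge> 2"
      using card_P c by simp
    then obtain d e where de: "d \<in> P" "d \<noteq> c" "e \<in> P" "e \<noteq> c" "d \<noteq> e"
      by (rule card_ge_2_obtain) blast
    have "card (nbrs V d) \<le> 4"
      unfolding nb[OF de(1,2)] using card_Un_le[of "{u, v}" "R - {z}"] u_neq_v 1 z by simp
    then obtain y where y: "y \<in> V" "dbl d y"
      using wdeg_4_dbl[OF fin, of d] wdeg_ge[of d] de subsets by auto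
    then have "adj e y"
      using nb[OF de(1,2)] nb[OF de(3,4)] dbl_imp_adj by (auto simp: nbrs_def)
    moreover obtain y' where "y' \<in> {u, v}" "y' \<noteq> y"
      using u_neq_v by blast
    moreover have "adj d w" "adj e w" if "w \<in> {u, v}" for w
      using that de P_eq_A adj_P adj_A by auto
    ultimately show False
      using dbl_not_in_C4[OF y(2), of e y'] de adj_sym by blast
  next
    case 2
    have "nbrs V z \<subseteq> {c} \<union> (R - {z})"
    proof
      fix y assume y: "y \<in> nbrs V z"
      then have "y \<notin> P - {c}"
        using other adj_sym by (auto simp: nbrs_def)
      moreover have "y \<noteq> u" "y \<noteq> v"
        using y R_nonadj[OF z] by (auto simp: nbrs_def)
      moreover have "y \<in> V" "y \<noteq> z"
        using y by (auto simp: nbrs_def)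
      ultimately show "y \<in> {c} \<union> (R - {z})"
        using V_eq P_eq_A by blast
    qed
    moreover have "card ({c} \<union> (R - {z})) \<le> 4"
      using card_Un_le[of "{c}" "R - {z}"] 2 z by simp
    ultimately have nz: "nbrs V z = {c} \<union> (R - {z})"
      using card_nbrs[OF zV] finite_sets by (intro card_seteq) auto
    have "\<not> nbrs V c \<subseteq> {u, v, z}"
    proof
      assume "nbrs V c \<subseteq> {u, v, z}"
      then have "card (nbrs V c) \<le> card {u, v, z}"
        by (intro card_mono) auto
      also have "\<dots> \<le> 3"
        by (simp add: card_insert_if)
      finally show False
        using card_nbrs[OF cV] by simp
    qed
    then obtain y where y: "y \<in> R" "y \<noteq> z" "adj c y"
      using nbrs_P[OF c] by (auto simp: nbrs_def)
    have yV: "y \<in> V"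
      using y subsets by auto
    have "nbrs V y \<subseteq> P \<union> {z}"
    proof
      fix w assume w: "w \<in> nbrs V y"
      have "w \<notin> R - {z}"
      proof
        assume wR: "w \<in> R - {z}"
        then have "adj z w"
          using nz by (auto simp: nbrs_def)
        moreover have "w \<noteq> c"
          using wR c R_disjoint by blast
        ultimately show False
          using dbl_not_in_C4[OF dbl, of w y] w y adj_sym by (auto simp: nbrs_def)
      qed
      moreover have "w \<noteq> u" "w \<noteq> v"
        using w R_nonadj[OF y(1)] by (auto simp: nbrs_def)
      moreover have "w \<in> V"
        using w by (auto simp: nbrs_def)
      ultimately show "w \<in> P \<union> {z}"
        using V_eq P_eq_A by blast
    qed
    then have ny: "nbrs V y \<subseteq> P \<union> {z}" .
    then have "card (nbrs V y) \<le> card (P \<union> {z})"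
      using finite_sets by (intro card_mono) auto
    also have "\<dots> \<le> 4"
      using card_Un_le[of P "{z}"] card_R(3)[OF 2] by simp
    finally have ny4: "card (nbrs V y) \<le> 4" .
    obtain w where "w \<in> V" "dbl y w"
      using wdeg_4_dbl[OF fin ny4 wdeg_ge[OF yV]] by blast
    then have w: "w \<in> V" "dbl y w" "w \<in> P \<union> {z}"
      using ny dbl_imp_adj by (auto simp: nbrs_def)
    have "w \<noteq> z" "w \<noteq> c"
      using unique[OF zV cV yV] unique[OF cV zV yV] dbl w y R_disjoint c dbl_sym by blast+
    then show False
      using dbl_not_in_C4[OF w(2), of u c] w y c adj_P adj_sym notin by blast
  qed
qed

lemma narcs_le: "narcs V \<le> 4 * card V - 10"
proof -
  have P_dbl: "\<not> dbl c z" if "c \<in> P" "z \<in> V" for c z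
  proof
    assume cz: "dbl c z"
    then have "z \<in> {u, v} \<union> R"
      using nbrs_P[OF that(1)] that dbl_imp_adj by (auto simp: nbrs_def)
    moreover have "z \<noteq> u" "z \<noteq> v"
      using unique[of u v c] unique[of v u c] cz that uv subsets notin dbl_sym by blast+
    ultimately show False
      using no_dbl_P_R[OF that(1)] cz by blast
  qed
  have card_nbrs_P: "card (nbrs V c) \<ge> 5" if "c \<in> P" for c
  proof -
    have "dnbrs V c = {}"
      using P_dbl[OF that] by (auto simp: dnbrs_def)
    then show ?thesis
      using wdeg_eq[OF fin, of c] wdeg_ge[of c] that subsets by auto
  qed
  have V: "V = {u, v} \<union> (P \<union> R)"
    using V_eq P_eq_A by auto
  have card_V: "card V = 2 + card P + card R"
    using finite_sets notin R_disjoint u_neq_v by (subst V) (simp add: card_Un_disjoint Int_commute)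
  have "narcs V = narcs {u, v} + narcs (P \<union> R) + (\<Sum>x\<in>{u, v}. wdeg (P \<union> R) x)"
    using finite_sets notin by (subst V, intro narcs_Un) auto
  moreover have "narcs {u, v} = 2"
    using u_neq_v uv dbl_imp_adj by (simp add: narcs_insert wdeg_insert mult_def)
  moreover have "narcs (P \<union> R) = narcs P + narcs R + (\<Sum>c\<in>P. wdeg R c)"
    using finite_sets R_disjoint by (intro narcs_Un) auto
  moreover have "narcs P = 0"
  proof -
    have "E \<inter> P \<times> P = {}"
      using P_A_nonadj P_eq_A by (auto simp: adj_def)
    then show ?thesis
      by (simp add: narcs_def)
  qed
  moreover have "(\<Sum>c\<in>P. wdeg R c) \<le> card P * card R"
  proof (rule sum_bounded_above[where K = "card R", simplified])
    fix c assume "c \<in> P"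
    then show "wdeg R c \<le> card R"
      using sum_bounded_above[of R "mult c" 1] mult_le_1 no_dbl_P_R by (simp add: wdeg_def)
  qed
  moreover have "(\<Sum>x\<in>{u, v}. wdeg (P \<union> R) x) \<le> 2 * card P"
  proof -
    have "wdeg (P \<union> R) x \<le> card P" if "x \<in> {u, v}" for x
    proof -
      have "\<not> adj x z" if "z \<in> R" for z
        using that \<open>x \<in> {u, v}\<close> R_nonadj by blast
      then have "wdeg R x = 0"
        unfolding wdeg_def by (intro sum.neutral) (simp add: mult_eq_0)
      moreover have "wdeg P x \<le> card P"
        using sum_bounded_above[of P "mult x" 1] mult_le_1 P_dbl that uv dbl_sym by (auto simp: wdeg_def)
      ultimately show ?thesis
        using finite_sets R_disjoint by (simp add: wdeg_Un Int_commute)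
    qed
    from this[of u] this[of v] show ?thesis
      using u_neq_v by simp
  qed
  ultimately have bound: "narcs V \<le> 2 + narcs R + card P * card R + 2 * card P"
    by linarith
  consider "card R = 3" "card P = 3" | "card R = 3" "card P = 4" | "card R = 4" "card P = 3"
  proof -
    have "card P + card R \<le> 7"
      using card_sum P_eq_A by simp
    then have "card R = 3 \<and> card P = 3 \<or> card R = 3 \<and> card P = 4 \<or> card R = 4 \<and> card P = 3"
      using card_R card_P by linarith
    then show ?thesis
      using that by blast
  qed
  moreover have "narcs R \<le> 4" if R3: "card R = 3"
  proof -
    obtain a b d where R: "R = {a, b, d}" "a \<noteq> b" "a \<noteq> d" "b \<noteq> d"
      using R3 by (auto simp: card_3_iff)
    obtain c where c: "c \<in> P"
      using card_P by fastforce
    have "nbrs V c = {u, v} \<union> R"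
      using nbrs_P[OF c] card_nbrs_P[OF c] R3 finite_sets card_Un_le[of "{u, v}" R] u_neq_v
      by (intro card_seteq) auto
    then have "\<not> (adj a b \<and> adj a d \<and> adj b d)"
      using no_K4[of c a b d] R c R_disjoint by (auto simp: nbrs_def)
    then have "mult a b = 0 \<or> mult a d = 0 \<or> mult b d = 0"
      by (simp add: mult_eq_0)
    then show ?thesis
      using narcs_3[OF R(2-4)] mult_le_2[of a b] mult_le_2[of a d] mult_le_2[of b d] R(1) by auto
  qed
  moreover have "narcs R \<le> 6" if "card R = 4"
    using unique subsets(3) by (intro narcs_4_le_6[OF that]) blast
  ultimately show ?thesis
    using bound card_V by cases auto
qed

end

context P13_free
begin

lemma narcs_le_of_wdeg_ge_5:
  assumes V: "finite V" "card V \<le> 9" "\<And>x. x \<in> V \<Longrightarrow> wdeg V x \<ge> 5" and "has_dbl V"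
  shows "narcs V \<le> 4 * card V - 10"
proof -
  obtain u v where "u \<in> V" "v \<in> V" "dbl u v"
    using \<open>has_dbl V\<close> by (auto simp: has_dbl_def)
  moreover have "card (nbrs V x) \<ge> 4" if "x \<in> V" for x
    using no_cubic_vertex[OF V that] card_nbrs_ge_3[OF V(1) V(3)[OF that]] by simp
  ultimately interpret dense_dbl E V u v
    using V by unfold_locales auto
  show ?thesis
    by (rule narcs_le)
qed

section \<open>At most nine vertices\<close>

lemma has_dbl_mono: "\<lbrakk>has_dbl U; U \<subseteq> V\<rbrakk> \<Longrightarrow> has_dbl V"
  by (auto simp: has_dbl_def)

lemma narcs_split:
  assumes "finite V" "S \<subseteq> V"
  shows "narcs V = narcs (V - S) + narcs S + (\<Sum>x\<in>V - S. wdeg S x)"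
proof -
  have "V - S \<union> S = V" "(V - S) \<inter> S = {}"
    using assms(2) by auto
  moreover have "finite S"
    using assms finite_subset by blast
  ultimately show ?thesis
    using narcs_Un[of "V - S" S] assms(1) by simp
qed

lemma narcs_le_of_outside:
  assumes "finite V" "S \<subseteq> V" "\<And>x. x \<in> V - S \<Longrightarrow> wdeg S x \<le> k"
  shows "narcs V \<le> narcs (V - S) + narcs S + card (V - S) * k"
  using narcs_split[OF assms(1,2)] sum_bounded_above[of "V - S" "wdeg S" k] assms(3) by simp

lemma wdeg_triangle:
  assumes T: "adj a b" "adj a c" "adj b c" and x: "x \<noteq> a" "x \<noteq> b" "x \<noteq> c"
  shows "wdeg {a, b, c} x \<le> 2"
proof -
  have ne: "a \<noteq> b" "a \<noteq> c" "b \<noteq> c"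
    using T by auto
  have *: "\<not> dbl x p \<and> \<not> dbl x q" if "adj x p" "adj x q" "adj p r" "adj q r" "x \<noteq> r" "p \<noteq> q" for p q r
    using that dbl_not_in_C4[of x p r q] dbl_not_in_C4[of x q r p] adj_sym by blast
  have "\<not> (adj x a \<and> adj x b \<and> adj x c)"
    using no_K4[of x a b c] T x ne by blast
  then show ?thesis
    using *[of a b c] *[of a c b] *[of b c a] T x ne adj_sym
    by (cases "adj x a"; cases "adj x b"; cases "adj x c")
      (auto simp: wdeg_insert mult_def adj_sym dest: dbl_imp_adj)
qed

lemma mantel:
  assumes "finite V" "\<not> has_dbl V" "\<And>a b c. \<lbrakk>a \<in> V; b \<in> V; c \<in> V\<rbrakk> \<Longrightarrow> \<not> (adj a b \<and> adj a c \<and> adj b c)"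
  shows "4 * narcs V \<le> (card V)\<^sup>2"
  using assms
proof (induction "card V" arbitrary: V rule: less_induct)
  case less
  show ?case
  proof (cases "\<exists>a\<in>V. \<exists>b\<in>V. adj a b")
    case False
    then have "E \<inter> V \<times> V = {}"
      by (auto simp: adj_def)
    then show ?thesis
      by (simp add: narcs_def)
  next
    case True
    then obtain a b where ab: "a \<in> V" "b \<in> V" "adj a b"
      by blast
    then have "a \<noteq> b"
      by auto
    note ab = ab this
    define U where "U = V - {a, b}"
    have card_U: "card V = card U + 2"
      using ab less.prems(1) card_mono[of V "{a, b}"] by (simp add: U_def card_Diff_subset)
    have "wdeg {a, b} x \<le> 1" if "x \<in> U" for x
      using less.prems(2) less.prems(3)[of x a b] that ab
      by (auto simp: U_def wdeg_insert mult_def has_dbl_def)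
    then have "narcs V \<le> narcs U + narcs {a, b} + card U * 1"
      using ab less.prems(1) unfolding U_def by (intro narcs_le_of_outside) auto
    moreover have "narcs {a, b} = 1"
      using ab less.prems(2) by (auto simp: narcs_insert wdeg_insert mult_def has_dbl_def)
    moreover have "4 * narcs U \<le> (card U)\<^sup>2"
    proof (rule less.hyps)
      show "card U < card V" "finite U" "\<not> has_dbl U"
        using less.prems card_U has_dbl_mono[of U V] by (auto simp: U_def)
    qed (use less.prems in \<open>auto simp: U_def\<close>)
    ultimately show ?thesis
      unfolding card_U by (simp add: power2_eq_square algebra_simps)
  qed
qed

lemma turan:
  assumes "finite V" "\<not> has_dbl V"
  shows "3 * narcs V \<le> (card V)\<^sup>2"
  using assms
proof (induction "card V" arbitrary: V rule: less_induct)
  case less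
  show ?case
  proof (cases "\<exists>a\<in>V. \<exists>b\<in>V. \<exists>c\<in>V. adj a b \<and> adj a c \<and> adj b c")
    case False
    then show ?thesis
    proof -
      have "4 * narcs V \<le> (card V)\<^sup>2"
        by (rule mantel[OF less.prems]) (use False in blast)
      then show ?thesis
        by linarith
    qed
  next
    case True
    then obtain a b c where T: "a \<in> V" "b \<in> V" "c \<in> V" "adj a b" "adj a c" "adj b c"
      by auto
    then have ne: "a \<noteq> b" "a \<noteq> c" "b \<noteq> c"
      by auto
    define U where "U = V - {a, b, c}"
    have card_U: "card V = card U + 3"
      using T ne less.prems(1) card_mono[of V "{a, b, c}"] by (simp add: U_def card_Diff_subset)
    have "narcs V \<le> narcs U + narcs {a, b, c} + card U * 2"
      using T less.prems(1) wdeg_triangle[OF T(4-6)] unfolding U_def by (intro narcs_le_of_outside) auto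
    moreover have "narcs {a, b, c} \<le> 3"
      using T ne less.prems(2) narcs_3[OF ne] by (auto simp: mult_def has_dbl_def)
    moreover have "3 * narcs U \<le> (card U)\<^sup>2"
    proof (rule less.hyps)
      show "card U < card V" "finite U" "\<not> has_dbl U"
        using less.prems card_U has_dbl_mono[of U V] by (auto simp: U_def)
    qed
    ultimately show ?thesis
      unfolding card_U by (simp add: power2_eq_square algebra_simps)
  qed
qed

lemma wdeg_C4:
  assumes "adj a b" "adj b c" "adj c d" "adj d a" "a \<noteq> c" "b \<noteq> d" "x \<notin> {a, b, c, d}"
  shows "mult x a + mult x c \<le> 2" "mult x b + mult x d \<le> 2"
    and "adj a c \<Longrightarrow> mult x a + mult x b + mult x c + mult x d \<le> 3"
proof -
  have *: "\<not> dbl x p \<and> \<not> dbl x q" if "adj x p" "adj x q" "adj p r" "adj q r" "x \<noteq> r" "p \<noteq> q" for p q r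
    using that dbl_not_in_C4[of x p r q] dbl_not_in_C4[of x q r p] adj_sym by blast
  have ac: "adj x a \<and> adj x c \<longrightarrow> \<not> dbl x a \<and> \<not> dbl x c"
    using *[of a c b] assms adj_sym by auto
  have bd: "adj x b \<and> adj x d \<longrightarrow> \<not> dbl x b \<and> \<not> dbl x d"
    using *[of b d a] assms adj_sym by auto
  show le: "mult x a + mult x c \<le> 2" "mult x b + mult x d \<le> 2"
    using ac bd by (auto simp: mult_def dest: dbl_imp_adj)
  assume diag: "adj a c"
  have sym: "adj b a" "adj c b" "adj d c" "adj a d" "adj c a"
    using assms diag adj_sym by blast+
  have ne: "x \<noteq> a" "x \<noteq> b" "x \<noteq> c" "x \<noteq> d" "a \<noteq> b" "a \<noteq> d" "c \<noteq> b" "c \<noteq> d" "b \<noteq> c" "d \<noteq> c"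
    using assms adj_neq by auto
  have "adj x a \<and> adj x b \<longrightarrow> \<not> dbl x a \<and> \<not> dbl x b" "adj x a \<and> adj x d \<longrightarrow> \<not> dbl x a \<and> \<not> dbl x d"
    "adj x c \<and> adj x b \<longrightarrow> \<not> dbl x c \<and> \<not> dbl x b" "adj x c \<and> adj x d \<longrightarrow> \<not> dbl x c \<and> \<not> dbl x d"
    using *[of a b c] *[of a d c] *[of c b a] *[of c d a] assms(1-4) diag sym ne by blast+
  moreover have "\<not> (adj x a \<and> adj x b \<and> adj x c)" "\<not> (adj x a \<and> adj x d \<and> adj x c)"
    using no_K4[of x a b c] no_K4[of x a d c] assms(1-6) diag sym ne by blast+
  ultimately show "mult x a + mult x b + mult x c + mult x d \<le> 3"
    using ac bd
    by (cases "adj x a"; cases "adj x b"; cases "adj x c"; cases "adj x d")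
      (auto simp: mult_def dest: dbl_imp_adj)
qed

lemma narcs_6_C4:
  assumes "finite V" "card V = 6"
    and C4: "a \<in> V" "b \<in> V" "c \<in> V" "d \<in> V" "adj a b" "adj b c" "adj c d" "adj d a" "a \<noteq> c" "b \<noteq> d"
    and diag: "\<not> adj b d"
  shows "narcs V \<le> 14"
proof -
  have ne: "a \<noteq> b" "a \<noteq> c" "a \<noteq> d" "b \<noteq> c" "b \<noteq> d" "c \<noteq> d"
    using C4 by auto
  define Y where "Y = {a, b, c, d}"
  have "card (V - Y) = 2"
    using assms ne by (simp add: Y_def card_Diff_subset)
  then obtain x y where xy: "V - Y = {x, y}" "x \<noteq> y"
    by (auto simp: card_2_iff)
  then have xyY: "x \<notin> {a, b, c, d}" "y \<notin> {a, b, c, d}"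
    unfolding Y_def by blast+
  have "narcs V = narcs {x, y} + narcs Y + (wdeg Y x + wdeg Y y)"
    using narcs_split[of V Y] assms xy by (simp add: Y_def)
  moreover have "narcs {x, y} \<le> 2"
    using xy mult_le_2[of x y] by (simp add: narcs_insert wdeg_insert)
  moreover have wY: "wdeg Y z = mult z a + mult z b + mult z c + mult z d" for z
    using ne by (simp add: Y_def wdeg_insert)
  moreover have "\<not> dbl a b" "\<not> dbl b c" "\<not> dbl c d" "\<not> dbl a d"
    using C4 dbl_not_in_C4[of a b c d] dbl_not_in_C4[of b c d a] dbl_not_in_C4[of c d a b]
      dbl_not_in_C4[of a d c b] adj_sym by blast+
  then have "narcs Y = 4 + mult a c"
    using C4 diag ne adj_sym by (auto simp: Y_def narcs_insert wdeg_insert mult_def dest: dbl_imp_adj)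
  moreover note wdeg_C4[OF C4(5-10) xyY(1)] wdeg_C4[OF C4(5-10) xyY(2)]
  ultimately show ?thesis
    using mult_le_2[of a c] mult_eq_0[of a c] by (cases "adj a c") simp_all
qed

lemma narcs_6_triangle:
  assumes V: "finite V" "card V = 6"
    and T: "a \<in> V" "b \<in> V" "c \<in> V" "adj a b" "adj a c" "adj b c"
    and noC4: "\<And>p q r s. \<lbrakk>p \<in> V; q \<in> V; r \<in> V; s \<in> V; p \<noteq> r; q \<noteq> s; adj p q; adj q r; adj r s; adj s p\<rbrakk> \<Longrightarrow> False"
  shows "narcs V \<le> 14"
proof -
  have ne: "a \<noteq> b" "a \<noteq> c" "b \<noteq> c"
    using T by auto
  define T' where "T' = {a, b, c}"
  have "card (V - T') = 3"
    using V T ne by (simp add: T'_def card_Diff_subset)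
  then obtain d e f where S: "V - T' = {d, e, f}" and def: "d \<noteq> e" "d \<noteq> f" "e \<noteq> f"
    by (auto simp: card_3_iff)
  have SV: "x \<in> V" "x \<notin> T'" if "x \<in> {d, e, f}" for x
    using S that by blast+
  have TV: "T' \<subseteq> V"
    using T by (simp add: T'_def)
  have T'adj: "adj t s" if "t \<in> T'" "s \<in> T'" "t \<noteq> s" for t s
    using T that adj_sym by (auto simp: T'_def)
  define N where "N x \<longleftrightarrow> (\<exists>t\<in>T'. adj x t)" for x
  have total: "narcs V = mult d e + mult d f + mult e f + narcs T' + (wdeg T' d + wdeg T' e + wdeg T' f)"
    using narcs_split[OF V(1) TV] S def by (simp add: add.assoc narcs_3)
  have "wdeg T' x \<le> 2" if "x \<in> {d, e, f}" for x
    using wdeg_triangle[OF T(4-6), of x] SV(2)[OF that] by (auto simp: T'_def)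
  then have wT: "wdeg T' d \<le> 2" "wdeg T' e \<le> 2" "wdeg T' f \<le> 2"
    by auto
  have wT0: "wdeg T' x = 0" if "\<not> N x" for x
    using that unfolding wdeg_def N_def by (intro sum.neutral) (simp add: mult_eq_0)
  have T_le: "narcs T' \<le> 6"
    using narcs_3[OF ne] mult_le_2[of a b] mult_le_2[of a c] mult_le_2[of b c] by (simp add: T'_def)
  have same: "s = t" if "x \<in> {d, e, f}" "y \<in> {d, e, f}" "adj x y" "s \<in> T'" "t \<in> T'" "adj x s" "adj y t" for x y s t
    using noC4[of x s t y] that SV[of x] SV[of y] TV T'adj adj_sym by (metis subsetD)
  have path: "\<not> (N x \<and> N y \<and> N z)"
    if "x \<in> {d, e, f}" "y \<in> {d, e, f}" "z \<in> {d, e, f}" "adj x y" "adj y z" "x \<noteq> z" for x y z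
  proof
    assume "N x \<and> N y \<and> N z"
    then obtain s t r where str: "s \<in> T'" "t \<in> T'" "r \<in> T'" "adj x s" "adj y t" "adj z r"
      by (auto simp: N_def)
    then have "s = t" "r = t"
      using same[of x y s t] same[of z y r t] that adj_sym by blast+
    then have "adj z t" "adj t x"
      using str adj_sym by blast+
    moreover have "x \<in> V" "y \<in> V" "z \<in> V" "t \<in> V" "y \<noteq> t"
      using str SV that TV by auto
    ultimately show False
      using noC4[of x y z t] that(4-6) by blast
  qed
  have tri: "\<not> (N x \<and> N y)"
    if "x \<in> {d, e, f}" "y \<in> {d, e, f}" "z \<in> {d, e, f}" "adj x y" "adj y z" "adj x z" for x y z
  proof
    assume "N x \<and> N y"
    then obtain s t where st: "s \<in> T'" "t \<in> T'" "adj x s" "adj y t"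
      by (auto simp: N_def)
    then have "s = t"
      using same[of x y s t] that by blast
    then have "adj x t" "adj t y" "adj z x"
      using st that adj_sym by blast+
    moreover have "x \<in> V" "y \<in> V" "z \<in> V" "t \<in> V" "t \<noteq> z"
      using st SV that TV by auto
    moreover have "x \<noteq> y"
      using that by auto
    ultimately show False
      using noC4[of x t y z] that(5) by blast
  qed
  have "adj d e \<and> adj e f \<longrightarrow> \<not> (N d \<and> N e \<and> N f)" "adj d e \<and> adj d f \<longrightarrow> \<not> (N d \<and> N e \<and> N f)"
    "adj d f \<and> adj e f \<longrightarrow> \<not> (N d \<and> N e \<and> N f)"
    using path[of d e f] path[of e d f] path[of d f e] def adj_sym by blast+
  moreover have "adj d e \<and> adj d f \<and> adj e f \<longrightarrow> \<not> (N d \<and> N e) \<and> \<not> (N d \<and> N f) \<and> \<not> (N e \<and> N f)"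
    using tri[of d e f] tri[of d f e] tri[of e f d] adj_sym by blast
  ultimately have bounds: "N d \<and> N e \<and> N f \<Longrightarrow> mult d e + mult d f + mult e f \<le> 2"
    "\<not> (adj d e \<and> adj d f \<and> adj e f) \<Longrightarrow> mult d e + mult d f + mult e f \<le> 4"
    "mult d e + mult d f + mult e f \<le> 6"
    "adj d e \<and> adj d f \<and> adj e f \<Longrightarrow> \<not> (N d \<and> N e) \<and> \<not> (N d \<and> N f) \<and> \<not> (N e \<and> N f)"
  proof -
    assume *: "adj d e \<and> adj e f \<longrightarrow> \<not> (N d \<and> N e \<and> N f)" "adj d e \<and> adj d f \<longrightarrow> \<not> (N d \<and> N e \<and> N f)"
      "adj d f \<and> adj e f \<longrightarrow> \<not> (N d \<and> N e \<and> N f)"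
      "adj d e \<and> adj d f \<and> adj e f \<longrightarrow> \<not> (N d \<and> N e) \<and> \<not> (N d \<and> N f) \<and> \<not> (N e \<and> N f)"
    have m: "mult x y \<le> 2 * of_bool (adj x y)" for x y
      using mult_le_2 mult_eq_0 by auto
    show "mult d e + mult d f + mult e f \<le> 2" if "N d \<and> N e \<and> N f"
      using that * m[of d e] m[of d f] m[of e f] by (cases "adj d e"; cases "adj d f"; cases "adj e f") simp_all
    show "mult d e + mult d f + mult e f \<le> 4" if "\<not> (adj d e \<and> adj d f \<and> adj e f)"
      using that m[of d e] m[of d f] m[of e f] by (cases "adj d e"; cases "adj d f"; cases "adj e f") simp_all
    show "mult d e + mult d f + mult e f \<le> 6"
      using mult_le_2[of d e] mult_le_2[of d f] mult_le_2[of e f] by linarith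
    show "\<not> (N d \<and> N e) \<and> \<not> (N d \<and> N f) \<and> \<not> (N e \<and> N f)" if "adj d e \<and> adj d f \<and> adj e f"
      using that *(4) by blast
  qed
  show ?thesis
  proof (cases "N d \<and> N e \<and> N f")
    case True
    then show ?thesis
      using bounds(1) total T_le wT by linarith
  next
    case False
    then have "wdeg T' d + wdeg T' e + wdeg T' f \<le> 4"
      using wT wT0[of d] wT0[of e] wT0[of f] by linarith
    moreover have "wdeg T' d + wdeg T' e + wdeg T' f \<le> 2" if "adj d e \<and> adj d f \<and> adj e f"
      using bounds(4)[OF that] wT wT0[of d] wT0[of e] wT0[of f] by (cases "N d"; cases "N e"; cases "N f") simp_all
    ultimately show ?thesis
      using bounds(2,3) total T_le by fastforce
  qed
qed

lemma narcs_4_forest: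
  assumes "card V = 4"
    and no_tri: "\<And>a b c. \<lbrakk>a \<in> V; b \<in> V; c \<in> V\<rbrakk> \<Longrightarrow> \<not> (adj a b \<and> adj a c \<and> adj b c)"
    and noC4: "\<And>p q r s. \<lbrakk>p \<in> V; q \<in> V; r \<in> V; s \<in> V; p \<noteq> r; q \<noteq> s; adj p q; adj q r; adj r s; adj s p\<rbrakk> \<Longrightarrow> False"
  shows "narcs V \<le> 6"
proof -
  obtain a b c d where S: "V = {a, b, c, d}" and ne: "a \<noteq> b" "a \<noteq> c" "a \<noteq> d" "b \<noteq> c" "b \<noteq> d" "c \<noteq> d"
    using card_4_obtain[OF assms(1)] by metis
  have "\<not> (adj a b \<and> adj a c \<and> adj b c)" "\<not> (adj a b \<and> adj a d \<and> adj b d)"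
    "\<not> (adj a c \<and> adj a d \<and> adj c d)" "\<not> (adj b c \<and> adj b d \<and> adj c d)"
    using no_tri by (auto simp: S)
  moreover have "\<not> (adj a b \<and> adj b c \<and> adj c d \<and> adj a d)" "\<not> (adj a b \<and> adj b d \<and> adj c d \<and> adj a c)"
    "\<not> (adj a c \<and> adj b c \<and> adj b d \<and> adj a d)"
    using noC4[of a b c d] noC4[of a b d c] noC4[of a c b d] ne adj_sym by (auto simp: S)
  ultimately show ?thesis
  proof -
    assume *: "\<not> (adj a b \<and> adj a c \<and> adj b c)" "\<not> (adj a b \<and> adj a d \<and> adj b d)"
      "\<not> (adj a c \<and> adj a d \<and> adj c d)" "\<not> (adj b c \<and> adj b d \<and> adj c d)"
      "\<not> (adj a b \<and> adj b c \<and> adj c d \<and> adj a d)" "\<not> (adj a b \<and> adj b d \<and> adj c d \<and> adj a c)"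
      "\<not> (adj a c \<and> adj b c \<and> adj b d \<and> adj a d)"
    have "of_bool (adj a b) + of_bool (adj a c) + of_bool (adj a d) + of_bool (adj b c) + of_bool (adj b d)
        + of_bool (adj c d) \<le> (3 :: nat)"
      using * by (cases "adj a b"; cases "adj a c"; cases "adj a d"; cases "adj b c"; cases "adj b d") auto
    moreover have "mult x y \<le> 2 * of_bool (adj x y)" for x y
      using mult_le_2 mult_eq_0 by auto
    note this[of a b] this[of a c] this[of a d] this[of b c] this[of b d] this[of c d]
    ultimately show ?thesis
      unfolding S narcs_4[OF ne] by linarith
  qed
qed

lemma narcs_6_le_14:
  assumes V: "finite V" "card V = 6"
  shows "narcs V \<le> 14"
proof (cases "\<exists>a\<in>V. \<exists>b\<in>V. \<exists>c\<in>V. \<exists>d\<in>V. a \<noteq> c \<and> b \<noteq> d \<and> adj a b \<and> adj b c \<and> adj c d \<and> adj d a")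
  case True
  then obtain a b c d where C4: "a \<in> V" "b \<in> V" "c \<in> V" "d \<in> V" "adj a b" "adj b c" "adj c d" "adj d a" "a \<noteq> c" "b \<noteq> d"
    by blast
  show ?thesis
  proof (cases "adj b d")
    case True
    then have "\<not> adj c a"
      using no_K4[of a b c d] C4 adj_sym adj_neq by metis
    then show ?thesis
      using narcs_6_C4[OF V, of b c d a] C4 by blast
  next
    case False
    then show ?thesis
      using narcs_6_C4[OF V C4] by blast
  qed
next
  case False
  then have noC4: False if "p \<in> V" "q \<in> V" "r \<in> V" "s \<in> V" "p \<noteq> r" "q \<noteq> s" "adj p q" "adj q r" "adj r s" "adj s p" for p q r s
    using that by blast
  show ?thesis
  proof (cases "\<exists>a\<in>V. \<exists>b\<in>V. \<exists>c\<in>V. adj a b \<and> adj a c \<and> adj b c")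
    case True
    then obtain a b c where T: "a \<in> V" "b \<in> V" "c \<in> V" "adj a b" "adj a c" "adj b c"
      by blast
    show ?thesis
      by (rule narcs_6_triangle[OF V T]) (fact noC4)
  next
    case no_tri: False
    have step: "narcs U \<le> 4 * card U - 10 \<or> (\<exists>x\<in>U. narcs U \<le> 4 + narcs (U - {x}))"
      if "finite U" "has_dbl U" "card U \<le> 9" for U
      using narcs_le_of_wdeg_ge_5[OF that(1,3) _ that(2)] narcs_remove[OF that(1)]
      by (metis add.commute add_le_mono1 not_less_eq_eq eval_nat_numeral(3))
    have five: "narcs U \<le> 10" if U: "U \<subseteq> V" "card U = 5" for U
    proof (cases "has_dbl U")
      case False
      then show ?thesis
        using turan[of U] U V finite_subset[of U V] by simp
    next
      case True
      have fin: "finite U"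
        using U V finite_subset by blast
      have "narcs (U - {x}) \<le> 6" if "x \<in> U" for x
      proof (rule narcs_4_forest)
        show "card (U - {x}) = 4"
          using that U by simp
        show "\<not> (adj a b \<and> adj a c \<and> adj b c)" if "a \<in> U - {x}" "b \<in> U - {x}" "c \<in> U - {x}" for a b c
          using that U(1) no_tri by blast
        show False if "p \<in> U - {x}" "q \<in> U - {x}" "r \<in> U - {x}" "s \<in> U - {x}" "p \<noteq> r" "q \<noteq> s"
          "adj p q" "adj q r" "adj r s" "adj s p" for p q r s
          by (rule noC4[OF _ _ _ _ that(5-10)]) (use that U(1) in blast)+
      qed
      then show ?thesis
        using step[OF fin True] U by force
    qed
    show ?thesis
    proof (cases "has_dbl V")
      case False
      then show ?thesis
        using turan[of V] V by simp
    next
      case True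
      then show ?thesis
      proof -
        have "narcs V \<le> 14 \<or> (\<exists>x\<in>V. narcs V \<le> 4 + narcs (V - {x}))"
          using step[OF V(1) True] V(2) by simp
        moreover have "narcs (V - {x}) \<le> 10" if "x \<in> V" for x
          using five[of "V - {x}"] that V by auto
        ultimately show ?thesis
          by force
      qed
    qed
  qed
qed

lemma narcs_small:
  assumes "finite V" "6 \<le> card V" "card V \<le> 9" "has_dbl V"
  shows "narcs V \<le> 4 * card V - 10"
  using assms
proof (induction "card V" arbitrary: V rule: less_induct)
  case less
  show ?case
  proof (cases "card V = 6")
    case True
    then show ?thesis
      using narcs_6_le_14[of V] less.prems by simp
  next
    case False
    show ?thesis
    proof (cases "\<forall>x\<in>V. wdeg V x \<ge> 5")
      case True
      then show ?thesis
        using narcs_le_of_wdeg_ge_5[of V] less.prems by blast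
    next
      case F: False
      then obtain x where x: "x \<in> V" "wdeg V x \<le> 4"
        by force
      have card_x: "card V = Suc (card (V - {x}))"
        using x less.prems(1) by (metis card_Suc_Diff1)
      have "narcs (V - {x}) \<le> 4 * card (V - {x}) - 10"
      proof (cases "has_dbl (V - {x})")
        case True
        then show ?thesis
          using less.hyps[of "V - {x}"] less.prems False card_x by simp
      next
        case nd: False
        have "card (V - {x}) = 6 \<or> card (V - {x}) = 7 \<or> card (V - {x}) = 8"
          using card_x less.prems False by linarith
        then show ?thesis
          using turan[OF _ nd] less.prems by auto
      qed
      then show ?thesis
        using narcs_remove[of V x] x less.prems card_x False by linarith
    qed
  qed
qed

section \<open>Extremal graphs are complete tripartite\<close>

text \<open>
  If every \<open>V - {x}\<close> contains a 2-cycle, average the induction hypothesis over \<open>x\<close>.  Otherwise all 2-cycles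
  pass through one vertex \<open>u\<close>, and two neighbours of \<open>u\<close> have large neighbourhoods which are disjoint
  outside \<open>u\<close>.
\<close>

lemma narcs_has_dbl:
  assumes "finite V" "card V \<ge> 9" "has_dbl V"
  shows "3 * narcs V + 3 \<le> (card V)\<^sup>2"
  using assms
proof (induction "card V" arbitrary: V rule: less_induct)
  case less
  define n where "n = card V"
  show ?case
  proof (cases "n = 9")
    case True
    then show ?thesis
      using narcs_small[of V] less.prems by (simp add: n_def)
  next
    case False
    then have n: "n \<ge> 10"
      using less.prems by (simp add: n_def)
    have card_x: "card (V - {x}) = n - 1" if "x \<in> V" for x
      using that less.prems(1) by (simp add: n_def)
    have sq: "(n - 1)\<^sup>2 + 2 * n = n\<^sup>2 + 1"
      using n by (cases n) (simp_all add: power2_eq_square)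
    have IH: "3 * narcs (V - {x}) + 3 \<le> (n - 1)\<^sup>2" if "x \<in> V" "has_dbl (V - {x})" for x
      using less.hyps[of "V - {x}"] that less.prems(1) card_x[OF that(1)] n by (simp add: n_def)
    show ?thesis
    proof (rule ccontr)
      assume neg: "\<not> ?thesis"
      have low: "3 * wdeg V x + 3 \<ge> 2 * n" if "x \<in> V" for x
      proof -
        have "3 * narcs (V - {x}) \<le> (n - 1)\<^sup>2"
          using IH[OF that] turan[of "V - {x}"] less.prems(1) card_x[OF that] by fastforce
        then show ?thesis
          using neg narcs_remove[OF less.prems(1) that] sq by (simp add: n_def)
      qed
      have high: "3 * wdeg V x \<ge> 2 * n" if "x \<in> V" "has_dbl (V - {x})" for x
        using IH[OF that] neg narcs_remove[OF less.prems(1) that(1)] sq by (simp add: n_def)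
      show False
      proof (cases "\<forall>x\<in>V. has_dbl (V - {x})")
        case True
        have "(\<Sum>x\<in>V. narcs (V - {x})) + 2 * narcs V = n * narcs V"
        proof -
          have "(\<Sum>x\<in>V. narcs (V - {x}) + wdeg V x) = (\<Sum>x\<in>V. narcs V)"
            using narcs_remove[OF less.prems(1)] by (intro sum.cong) simp_all
          then show ?thesis
            using sum_wdeg[OF less.prems(1)] by (simp add: sum.distrib n_def)
        qed
        moreover have "(\<Sum>x\<in>V. 3 * narcs (V - {x}) + 3) \<le> n * (n - 1)\<^sup>2"
          using sum_bounded_above[of V "\<lambda>x. 3 * narcs (V - {x}) + 3"] IH True by (simp add: n_def)
        then have "3 * (\<Sum>x\<in>V. narcs (V - {x})) + 3 * n \<le> n * (n - 1)\<^sup>2"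
          by (simp add: sum.distrib sum_distrib_left n_def)
        ultimately have "3 * (n * narcs V) + 3 * n \<le> n * (n - 1)\<^sup>2 + 6 * narcs V"
          by linarith
        moreover obtain m where m: "n = m + 2"
          using le_Suc_ex[of 2 n] n by auto
        ultimately have "3 * narcs V * m + 3 * (m + 2) \<le> (m + 2) * (m + 1)\<^sup>2"
          by (simp add: algebra_simps)
        moreover have "(m + 2)\<^sup>2 < 3 * narcs V + 3"
          using neg m by (simp add: n_def)
        then have "(m + 2)\<^sup>2 * m \<le> (3 * narcs V + 2) * m"
          by (intro mult_right_mono) auto
        ultimately show False
          by (simp add: power2_eq_square algebra_simps)
      next
        case False
        then obtain u where u: "u \<in> V" "\<not> has_dbl (V - {u})"
          by blast
        obtain v where v: "v \<in> V" "dbl u v"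
        proof -
          obtain x y where xy: "x \<in> V" "y \<in> V" "dbl x y"
            using less.prems(3) by (auto simp: has_dbl_def)
          then have "x = u \<or> y = u"
            using u by (auto simp: has_dbl_def)
          then show ?thesis
            using that xy dbl_sym by blast
        qed
        have dn: "dnbrs V x \<subseteq> {u}" if "x \<in> V" "x \<noteq> u" for x
          using u that by (auto simp: has_dbl_def dnbrs_def)
        have "\<not> nbrs V u \<subseteq> {v}"
        proof
          assume "nbrs V u \<subseteq> {v}"
          then have "card (nbrs V u) \<le> 1"
            using card_mono[of "{v}" "nbrs V u"] by simp
          then show False
            using low[OF u(1)] n wdeg_eq[OF less.prems(1), of u] card_dnbrs_le[OF less.prems(1), of u] by linarith
        qed
        then obtain w where w: "w \<in> V" "adj u w" "w \<noteq> v"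
          by (auto simp: nbrs_def)
        have ne: "u \<noteq> v" "u \<noteq> w"
          using v w by auto
        have card_B: "card (nbrs V x - {u}) + 1 + card (dnbrs V x) = wdeg V x" if "x \<in> V" "adj u x" for x
        proof -
          have "u \<in> nbrs V x"
            using that u adj_sym by (auto simp: nbrs_def)
          then show ?thesis
            using wdeg_eq[OF less.prems(1), of x] card_Suc_Diff1[OF finite_nbrs[OF less.prems(1)]] by simp
        qed
        have "card ((nbrs V v - {u}) \<union> (nbrs V w - {u})) \<le> card (V - {u})"
          using less.prems(1) by (intro card_mono) (auto simp: nbrs_def)
        moreover have "card ((nbrs V v - {u}) \<union> (nbrs V w - {u})) = card (nbrs V v - {u}) + card (nbrs V w - {u})"
          using nbrs_disjoint[OF v(2) w(2)] w(3) finite_nbrs[OF less.prems(1)] by (intro card_Un_disjoint) auto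
        ultimately have sum: "card (nbrs V v - {u}) + card (nbrs V w - {u}) + 1 \<le> n"
          using card_x[OF u(1)] n by linarith
        have dv: "card (dnbrs V v) \<le> 1" and dw: "card (dnbrs V w) \<le> 1"
          using card_mono[OF _ dn[of v]] card_mono[OF _ dn[of w]] v w ne by auto
        have "has_dbl (V - {w})"
          using u v w ne by (auto simp: has_dbl_def)
        note hw = high[OF w(1) this]
        show False
        proof (cases "dbl u w")
          case True
          then have "has_dbl (V - {v})"
            using u v w ne by (auto simp: has_dbl_def)
          note hv = high[OF v(1) this]
          show ?thesis
            using hv hw sum dv dw card_B[OF v(1)] card_B[OF w(1,2)] dbl_imp_adj[OF v(2)] n by linarith
        next
          case False
          then have "dnbrs V w = {}"
            using dn[OF w(1)] ne dbl_sym by (auto simp: dnbrs_def)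
          then have "card (dnbrs V w) = 0"
            by simp
          then show ?thesis
            using low[OF v(1)] hw sum dv card_B[OF v(1)] card_B[OF w(1,2)] dbl_imp_adj[OF v(2)] n by linarith
        qed
      qed
    qed
  qed
qed

definition tripartition :: "'a set \<Rightarrow> 'a set \<Rightarrow> 'a set \<Rightarrow> 'a set \<Rightarrow> bool" where
  "tripartition V X Y Z \<longleftrightarrow> V = X \<union> Y \<union> Z \<and> X \<inter> Y = {} \<and> X \<inter> Z = {} \<and> Y \<inter> Z = {} \<and>
    (\<forall>A\<in>{X, Y, Z}. \<forall>x\<in>A. \<forall>y\<in>A. \<not> adj x y)"

lemma sum_wdeg_eq:
  assumes "finite A" "finite B" "\<And>x y. \<lbrakk>x \<in> A; y \<in> B\<rbrakk> \<Longrightarrow> \<not> dbl x y"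
  shows "(\<Sum>x\<in>A. wdeg B x) + card {(x, y) \<in> A \<times> B. \<not> adj x y} = card A * card B"
proof -
  have "(\<Sum>x\<in>A. wdeg B x) = (\<Sum>x\<in>A. \<Sum>y\<in>B. of_bool (adj x y))"
    unfolding wdeg_def using assms(3) by (intro sum.cong refl) (simp add: mult_def)
  also have "\<dots> = (\<Sum>p\<in>A \<times> B. of_bool (adj (fst p) (snd p)))"
    by (simp add: sum.cartesian_product case_prod_beta)
  also have "\<dots> = card {p \<in> A \<times> B. adj (fst p) (snd p)}"
    using assms by (simp add: Collect_conj_eq)
  finally have 1: "(\<Sum>x\<in>A. wdeg B x) = card {p \<in> A \<times> B. adj (fst p) (snd p)}" .
  have "card {p \<in> A \<times> B. adj (fst p) (snd p)} + card {(x, y) \<in> A \<times> B. \<not> adj x y} =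
      card ({p \<in> A \<times> B. adj (fst p) (snd p)} \<union> {(x, y) \<in> A \<times> B. \<not> adj x y})"
    using assms by (intro card_Un_disjoint[symmetric]) (auto intro: finite_subset[of _ "A \<times> B"])
  also have "{p \<in> A \<times> B. adj (fst p) (snd p)} \<union> {(x, y) \<in> A \<times> B. \<not> adj x y} = A \<times> B"
    by auto
  finally show ?thesis
    using 1 by (simp add: card_cartesian_product)
qed

lemma narcs_tripartition:
  assumes V: "finite V" "\<not> has_dbl V" and part: "tripartition V X Y Z"
  shows "narcs V + card {(x, y) \<in> X \<times> Y. \<not> adj x y} + card {(x, z) \<in> X \<times> Z. \<not> adj x z}
      + card {(y, z) \<in> Y \<times> Z. \<not> adj y z} = card X * card Y + card X * card Z + card Y * card Z"
proof -
  have V_eq: "V = X \<union> (Y \<union> Z)" and disj: "X \<inter> Y = {}" "X \<inter> Z = {}" "Y \<inter> Z = {}"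
    and indep: "\<And>A x y. \<lbrakk>A \<in> {X, Y, Z}; x \<in> A; y \<in> A\<rbrakk> \<Longrightarrow> \<not> adj x y"
    using part by (auto simp: tripartition_def)
  have fin: "finite X" "finite Y" "finite Z"
    using V V_eq by auto
  have zero: "narcs A = 0" if "A \<in> {X, Y, Z}" for A
  proof -
    have "E \<inter> A \<times> A = {}"
      using indep[OF that] by (auto simp: adj_def)
    then show ?thesis
      by (simp add: narcs_def)
  qed
  have no_dbl: "\<not> dbl x y" if "x \<in> V" "y \<in> V" for x y
    using V(2) that by (auto simp: has_dbl_def)
  have "narcs V = narcs (Y \<union> Z) + (\<Sum>x\<in>X. wdeg (Y \<union> Z) x)"
    unfolding V_eq using fin disj zero[of X] by (subst narcs_Un) auto
  also have "narcs (Y \<union> Z) = (\<Sum>y\<in>Y. wdeg Z y)"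
    using fin disj zero by (subst narcs_Un) auto
  also have "(\<Sum>x\<in>X. wdeg (Y \<union> Z) x) = (\<Sum>x\<in>X. wdeg Y x) + (\<Sum>x\<in>X. wdeg Z x)"
    using fin disj by (simp add: wdeg_Un sum.distrib)
  finally show ?thesis
    using sum_wdeg_eq[OF fin(1,2)] sum_wdeg_eq[OF fin(1,3)] sum_wdeg_eq[OF fin(2,3)] no_dbl V_eq by simp
qed

lemma tripartition_exists:
  assumes V: "finite V" "card V \<ge> 4" "\<not> has_dbl V" and large: "(card V)\<^sup>2 < 3 * narcs V + 3"
  obtains X Y Z where "tripartition V X Y Z"
proof -
  have "\<exists>a\<in>V. \<exists>b\<in>V. \<exists>c\<in>V. adj a b \<and> adj a c \<and> adj b c"
  proof (rule ccontr)
    assume neg: "\<not> ?thesis"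
    have "4 * narcs V \<le> (card V)\<^sup>2"
      by (rule mantel[OF V(1,3)]) (use neg in blast)
    moreover have "4\<^sup>2 \<le> (card V)\<^sup>2"
      using V(2) by (intro power_mono) auto
    ultimately show False
      using large by simp
  qed
  then obtain a b c where T: "a \<in> V" "b \<in> V" "c \<in> V" "adj a b" "adj a c" "adj b c"
    by blast
  then have ne: "a \<noteq> b" "a \<noteq> c" "b \<noteq> c"
    by auto
  have no_dbl: "\<not> dbl x y" if "x \<in> V" "y \<in> V" for x y
    using V(3) that by (auto simp: has_dbl_def)
  define U where "U = V - {a, b, c}"
  have finU: "finite U"
    using V by (simp add: U_def)
  have card_U: "card V = card U + 3"
    using T ne V card_mono[of V "{a, b, c}"] by (simp add: U_def card_Diff_subset)
  have le2: "wdeg {a, b, c} x \<le> 2" if "x \<in> U" for x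
    using wdeg_triangle[OF T(4-6), of x] that by (simp add: U_def)
  have eq2: "wdeg {a, b, c} x = 2" if "x \<in> U" for x
  proof (rule ccontr)
    assume "wdeg {a, b, c} x \<noteq> 2"
    then have "wdeg {a, b, c} x \<le> 1"
      using le2[OF that] by simp
    moreover have "(\<Sum>y\<in>U - {x}. wdeg {a, b, c} y) \<le> card (U - {x}) * 2"
      using sum_bounded_above[of "U - {x}" "wdeg {a, b, c}" 2] le2 by simp
    moreover have "card U = Suc (card (U - {x}))"
      using finU that by (metis card_Suc_Diff1)
    ultimately have "(\<Sum>y\<in>U. wdeg {a, b, c} y) + 1 \<le> card U * 2"
      using sum.remove[OF finU that, of "wdeg {a, b, c}"] by simp
    moreover have "narcs V = narcs U + narcs {a, b, c} + (\<Sum>y\<in>U. wdeg {a, b, c} y)"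
      unfolding U_def using T V by (intro narcs_split) auto
    moreover have "narcs {a, b, c} \<le> 3"
      using no_dbl T mult_le_1[of a b] mult_le_1[of a c] mult_le_1[of b c] narcs_3[OF ne] by simp
    moreover have "3 * narcs U \<le> (card U)\<^sup>2"
      using V has_dbl_mono[of U V] by (intro turan) (auto simp: U_def)
    ultimately show False
      using large unfolding card_U by (simp add: power2_eq_square algebra_simps)
  qed
  define I where "I t = {x \<in> V. \<not> adj x t}" for t
  have two: "(\<not> adj x a \<and> adj x b \<and> adj x c) \<or> (adj x a \<and> \<not> adj x b \<and> adj x c) \<or> (adj x a \<and> adj x b \<and> \<not> adj x c)"
    if "x \<in> V" for x
  proof (cases "x \<in> U")
    case True
    have "\<not> dbl x a" "\<not> dbl x b" "\<not> dbl x c"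
      using no_dbl T that by auto
    then show ?thesis
      using eq2[OF True] ne by (auto simp: wdeg_insert mult_def of_bool_def split: if_splits)
  next
    case False
    then show ?thesis
      using that T adj_sym by (auto simp: U_def)
  qed
  have ind: "\<not> adj x y" if xy: "x \<in> V" "y \<in> V" "\<not> adj x p" "\<not> adj y p" and p: "p \<in> {a, b, c}" for x y p
  proof
    assume "adj x y"
    moreover obtain q r where qr: "q \<in> {a, b, c}" "r \<in> {a, b, c}" "q \<noteq> p" "r \<noteq> p" "adj q r"
      using p T ne ne[symmetric] by (elim insertE emptyE) blast+
    moreover have "adj x t" "adj y t" if "t \<in> {a, b, c}" "t \<noteq> p" for t
      using two[OF xy(1)] two[OF xy(2)] xy(3,4) p that by auto
    ultimately show False
      using no_K4[of x y q r] adj_neq by blast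
  qed
  have "tripartition V (I a) (I b) (I c)"
    unfolding tripartition_def
  proof (intro conjI)
    show "V = I a \<union> I b \<union> I c" "I a \<inter> I b = {}" "I a \<inter> I c = {}" "I b \<inter> I c = {}"
      using two by (auto simp: I_def)
    show "\<forall>A\<in>{I a, I b, I c}. \<forall>x\<in>A. \<forall>y\<in>A. \<not> adj x y"
      using ind by (auto simp: I_def)
  qed
  then show ?thesis
    by (rule that)
qed

end

lemma three_products_sum:
  fixes x y z :: nat
  shows "3 * (x * y + x * z + y * z) \<le> (x + y + z)\<^sup>2"
    and "x \<ge> y + 2 \<Longrightarrow> 3 * (x * y + x * z + y * z) + 3 \<le> (x + y + z)\<^sup>2"
proof -
  have eq: "4 * ((int x + int y + int z)\<^sup>2 - 3 * (int x * int y + int x * int z + int y * int z)) =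
      3 * (int x - int y)\<^sup>2 + (2 * int z - int x - int y)\<^sup>2"
    by (simp add: power2_eq_square algebra_simps)
  then have "(int x + int y + int z)\<^sup>2 \<ge> 3 * (int x * int y + int x * int z + int y * int z)"
    by (smt (verit) zero_le_power2)
  then have "int (3 * (x * y + x * z + y * z)) \<le> int ((x + y + z)\<^sup>2)"
    by simp
  then show "3 * (x * y + x * z + y * z) \<le> (x + y + z)\<^sup>2"
    by (simp only: of_nat_le_iff)
  assume "x \<ge> y + 2"
  then have "2\<^sup>2 \<le> (int x - int y)\<^sup>2"
    by (intro power_mono) auto
  then have "4 \<le> (int x - int y)\<^sup>2"
    by simp
  then have "(int x + int y + int z)\<^sup>2 \<ge> 3 * (int x * int y + int x * int z + int y * int z) + 3"
    using eq by (smt (verit) zero_le_power2)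
  then have "int (3 * (x * y + x * z + y * z) + 3) \<le> int ((x + y + z)\<^sup>2)"
    by simp
  then show "3 * (x * y + x * z + y * z) + 3 \<le> (x + y + z)\<^sup>2"
    by (simp only: of_nat_le_iff)
qed

lemma balanced_products_sum:
  fixes x y z :: nat
  assumes "\<forall>p\<in>{x, y, z}. \<forall>q\<in>{x, y, z}. p \<le> q + 1"
  shows "x * y + x * z + y * z = (x + y + z)\<^sup>2 div 3"
proof -
  define m where "m = min x (min y z)"
  have "x = m \<or> x = m + 1" "y = m \<or> y = m + 1" "z = m \<or> z = m + 1"
    using assms by (auto simp: m_def min_def)
  then have "(x + y + z)\<^sup>2 = 3 * (x * y + x * z + y * z) \<or> (x + y + z)\<^sup>2 = 3 * (x * y + x * z + y * z) + 1"
    by (auto simp: power2_eq_square algebra_simps)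
  then show ?thesis
    by auto
qed

context P13_free
begin

lemma extremal_tripartition:
  assumes V: "finite V" "card V \<ge> 9" and large: "(card V)\<^sup>2 < 3 * narcs V + 3"
  obtains X Y Z where "tripartition V X Y Z" "\<not> has_dbl V"
    "\<forall>A\<in>{X, Y, Z}. \<forall>B\<in>{X, Y, Z}. card A \<le> card B + 1"
    "\<forall>x\<in>X. \<forall>y\<in>Y. adj x y" "\<forall>x\<in>X. \<forall>z\<in>Z. adj x z" "\<forall>y\<in>Y. \<forall>z\<in>Z. adj y z"
proof -
  have no_dbl: "\<not> has_dbl V"
    using narcs_has_dbl[OF V] large by fastforce
  obtain X Y Z where part: "tripartition V X Y Z"
    using tripartition_exists[OF V(1) _ no_dbl large] V(2) by fastforce
  then have V_eq: "V = X \<union> Y \<union> Z" and disj: "X \<inter> Y = {}" "X \<inter> Z = {}" "Y \<inter> Z = {}"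
    by (simp_all add: tripartition_def)
  have fin: "finite X" "finite Y" "finite Z"
    using V V_eq by auto
  have card_V: "card V = card X + card Y + card Z"
    unfolding V_eq using fin disj by (simp add: card_Un_disjoint Int_Un_distrib2)
  note count = narcs_tripartition[OF V(1) no_dbl part]
  define Q where "Q = card X * card Y + card X * card Z + card Y * card Z"
  note count = count[folded Q_def]
  have Q: "3 * Q \<le> (card V)\<^sup>2" "(card V)\<^sup>2 < 3 * Q + 3"
    using three_products_sum(1)[of "card X" "card Y" "card Z"] count large by (auto simp: card_V Q_def)
  have "{(x, y) \<in> X \<times> Y. \<not> adj x y} = {}" "{(x, z) \<in> X \<times> Z. \<not> adj x z} = {}" "{(y, z) \<in> Y \<times> Z. \<not> adj y z} = {}"
  proof -
    have "card {(x, y) \<in> X \<times> Y. \<not> adj x y} + card {(x, z) \<in> X \<times> Z. \<not> adj x z} + card {(y, z) \<in> Y \<times> Z. \<not> adj y z} = 0"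
      using count Q large by linarith
    moreover have "finite {(p, q) \<in> A \<times> B. \<not> adj p q}" if "finite A" "finite B" for A B
      using that by (auto intro: finite_subset[of _ "A \<times> B"])
    ultimately show "{(x, y) \<in> X \<times> Y. \<not> adj x y} = {}" "{(x, z) \<in> X \<times> Z. \<not> adj x z} = {}"
      "{(y, z) \<in> Y \<times> Z. \<not> adj y z} = {}"
      using fin by auto
  qed
  moreover have "\<forall>A\<in>{X, Y, Z}. \<forall>B\<in>{X, Y, Z}. card A \<le> card B + 1"
  proof -
    have "p \<le> q + 1" if "p * q + p * r + q * r = Q" "p + q + r = card V" for p q r
      using three_products_sum(2)[of q p r] Q that by (cases "p \<le> q + 1") auto
    note this[of "card X" "card Y" "card Z"] this[of "card X" "card Z" "card Y"]
      this[of "card Y" "card X" "card Z"] this[of "card Y" "card Z" "card X"]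
      this[of "card Z" "card X" "card Y"] this[of "card Z" "card Y" "card X"]
    then show ?thesis
      by (simp add: Q_def card_V algebra_simps)
  qed
  ultimately show ?thesis
    using that[OF part no_dbl] by blast
qed

lemma C4_parity:
  assumes "distinct [p, q, r, s]" "adj p q" "adj q r" "adj r s" "adj s p"
    and "\<not> dbl p q" "\<not> dbl q r" "\<not> dbl r s" "\<not> dbl s p"
  shows "((p, q) \<in> E \<longleftrightarrow> (q, r) \<in> E) \<longleftrightarrow> ((r, s) \<in> E \<longleftrightarrow> (s, p) \<in> E)"
proof -
  have ne: "p \<noteq> q" "p \<noteq> r" "p \<noteq> s" "q \<noteq> r" "q \<noteq> s" "r \<noteq> s"
    using assms(1) by auto
  note free = no_P13[of p q r s, OF ne] no_P13[of q r s p] no_P13[of r s p q] no_P13[of s p q r]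
    no_P13[of q p s r] no_P13[of p s r q] no_P13[of s r q p] no_P13[of r q p s]
  show ?thesis
    using free[simplified ne ne[symmetric] simp_thms] assms(2-9) unfolding adj_def dbl_def by argo
qed

end

section \<open>Orientations of complete tripartite graphs\<close>

definition arcs_one_way :: "('a \<times> 'a) set \<Rightarrow> 'a set \<Rightarrow> 'a set \<Rightarrow> bool" where
  "arcs_one_way E U W \<longleftrightarrow> (\<forall>u\<in>U. \<forall>w\<in>W. (u, w) \<in> E \<and> (w, u) \<notin> E)"

definition six_classes :: "('a \<times> 'a) set \<Rightarrow> 'a set \<Rightarrow> 'a set \<Rightarrow> 'a set \<Rightarrow> bool" where
  "six_classes E X Y Z \<longleftrightarrow> (\<exists>X1 X2 Y1 Y2 Z1 Z2.
      X = X1 \<union> X2 \<and> X1 \<inter> X2 = {} \<and>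
      Y = Y1 \<union> Y2 \<and> Y1 \<inter> Y2 = {} \<and>
      Z = Z1 \<union> Z2 \<and> Z1 \<inter> Z2 = {} \<and>
      arcs_one_way E X1 (Y1 \<union> Z2) \<and> arcs_one_way E Y1 (Z1 \<union> X2) \<and> arcs_one_way E Z1 (X1 \<union> Y2) \<and>
      arcs_one_way E X2 (Y2 \<union> Z1) \<and> arcs_one_way E Y2 (Z2 \<union> X1) \<and> arcs_one_way E Z2 (X2 \<union> Y1))"

lemma six_classesI:
  assumes "X = X1 \<union> X2" "X1 \<inter> X2 = {}" "Y = Y1 \<union> Y2" "Y1 \<inter> Y2 = {}" "Z = Z1 \<union> Z2" "Z1 \<inter> Z2 = {}"
    "arcs_one_way E X1 (Y1 \<union> Z2)" "arcs_one_way E Y1 (Z1 \<union> X2)" "arcs_one_way E Z1 (X1 \<union> Y2)"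
    "arcs_one_way E X2 (Y2 \<union> Z1)" "arcs_one_way E Y2 (Z2 \<union> X1)" "arcs_one_way E Z2 (X2 \<union> Y1)"
  shows "six_classes E X Y Z"
  unfolding six_classes_def by (intro exI conjI) (fact assms)+

lemma six_classesE:
  assumes "six_classes E X Y Z"
  obtains X1 X2 Y1 Y2 Z1 Z2 where
    "X = X1 \<union> X2" "X1 \<inter> X2 = {}" "Y = Y1 \<union> Y2" "Y1 \<inter> Y2 = {}" "Z = Z1 \<union> Z2" "Z1 \<inter> Z2 = {}"
    "arcs_one_way E X1 (Y1 \<union> Z2)" "arcs_one_way E Y1 (Z1 \<union> X2)" "arcs_one_way E Z1 (X1 \<union> Y2)"
    "arcs_one_way E X2 (Y2 \<union> Z1)" "arcs_one_way E Y2 (Z2 \<union> X1)" "arcs_one_way E Z2 (X2 \<union> Y1)"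
proof -
  obtain X1 X2 Y1 Y2 Z1 Z2 where
    "X = X1 \<union> X2 \<and> X1 \<inter> X2 = {} \<and> Y = Y1 \<union> Y2 \<and> Y1 \<inter> Y2 = {} \<and> Z = Z1 \<union> Z2 \<and> Z1 \<inter> Z2 = {} \<and>
      arcs_one_way E X1 (Y1 \<union> Z2) \<and> arcs_one_way E Y1 (Z1 \<union> X2) \<and> arcs_one_way E Z1 (X1 \<union> Y2) \<and>
      arcs_one_way E X2 (Y2 \<union> Z1) \<and> arcs_one_way E Y2 (Z2 \<union> X1) \<and> arcs_one_way E Z2 (X2 \<union> Y1)"
    using assms unfolding six_classes_def by (elim exE)
  then show ?thesis
    using that by blast
qed

context P13_free
begin

text \<open>
  On an even triangle \<open>x0 y0 z0\<close> the class of each vertex can be read off its arc to \<open>x0\<close> or \<open>y0\<close>;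
  the parity of the 4-cycles through these vertices then determines all other arcs.
\<close>

lemma six_classes_of_even_triangle:
  assumes disj: "X \<inter> Y = {}" "X \<inter> Z = {}" "Y \<inter> Z = {}"
    and adjs: "\<And>x y. \<lbrakk>x \<in> X; y \<in> Y\<rbrakk> \<Longrightarrow> adj x y" "\<And>x z. \<lbrakk>x \<in> X; z \<in> Z\<rbrakk> \<Longrightarrow> adj x z"
      "\<And>y z. \<lbrakk>y \<in> Y; z \<in> Z\<rbrakk> \<Longrightarrow> adj y z"
    and no_dbl: "\<And>p q. \<lbrakk>p \<in> X \<union> Y \<union> Z; q \<in> X \<union> Y \<union> Z\<rbrakk> \<Longrightarrow> \<not> dbl p q"
    and base: "x0 \<in> X" "y0 \<in> Y" "z0 \<in> Z"
    and even: "((x0, y0) \<in> E \<longleftrightarrow> (y0, z0) \<in> E) \<longleftrightarrow> (z0, x0) \<in> E"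
  shows "six_classes E X Y Z"
proof -
  have rev: "(q, p) \<in> E \<longleftrightarrow> (p, q) \<notin> E"
    if "p \<in> X \<and> q \<in> Y \<or> p \<in> Y \<and> q \<in> Z \<or> p \<in> Z \<and> q \<in> X" for p q
    using that adjs no_dbl unfolding adj_def dbl_def by blast
  define i where "i v \<longleftrightarrow> (if v \<in> X then (v, y0) \<in> E \<longleftrightarrow> (x0, y0) \<in> E else if v \<in> Y then (x0, v) \<in> E else (v, x0) \<in> E)" for v
  have iX: "i x \<longleftrightarrow> ((x, y0) \<in> E \<longleftrightarrow> (x0, y0) \<in> E)" if "x \<in> X" for x
    using that by (simp add: i_def)
  have iY: "i y \<longleftrightarrow> (x0, y) \<in> E" if "y \<in> Y" for y
    using that disj by (auto simp: i_def)
  have iZ: "i z \<longleftrightarrow> (z, x0) \<in> E" if "z \<in> Z" for z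
    using that disj by (auto simp: i_def)
  have XY: "(x, y) \<in> E \<longleftrightarrow> (i x \<longleftrightarrow> i y)" if "x \<in> X" "y \<in> Y" for x y
  proof (cases "x = x0 \<or> y = y0")
    case True
    then show ?thesis
      using that base by (auto simp: iX iY)
  next
    case False
    have "((x, y) \<in> E \<longleftrightarrow> (y, x0) \<in> E) \<longleftrightarrow> ((x0, y0) \<in> E \<longleftrightarrow> (y0, x) \<in> E)"
      using False that base disj adjs adj_sym no_dbl by (intro C4_parity) auto
    then show ?thesis
      using rev[of x0 y] rev[of x y0] that base by (auto simp: iX iY)
  qed
  have ZX: "(z, x) \<in> E \<longleftrightarrow> (i z \<longleftrightarrow> i x)" if "z \<in> Z" "x \<in> X" for x z
  proof (cases "x = x0")
    case True
    then show ?thesis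
      using that base by (auto simp: iX iZ)
  next
    case False
    have "((z, x) \<in> E \<longleftrightarrow> (x, y0) \<in> E) \<longleftrightarrow> ((y0, x0) \<in> E \<longleftrightarrow> (x0, z) \<in> E)"
      using False that base disj adjs adj_sym no_dbl by (intro C4_parity) auto
    then show ?thesis
      using rev[of x0 y0] rev[of z x0] that base by (auto simp: iX iZ)
  qed
  have y0Z: "(y0, z) \<in> E \<longleftrightarrow> (i y0 \<longleftrightarrow> i z)" if "z \<in> Z" for z
  proof (cases "z = z0")
    case True
    then show ?thesis
      using even base by (auto simp: iY iZ)
  next
    case False
    have "((y0, z) \<in> E \<longleftrightarrow> (z, x0) \<in> E) \<longleftrightarrow> ((x0, z0) \<in> E \<longleftrightarrow> (z0, y0) \<in> E)"
      using False that base disj adjs adj_sym no_dbl by (intro C4_parity) auto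
    then show ?thesis
      using rev[of z0 x0] rev[of y0 z0] even that base by (auto simp: iY iZ)
  qed
  have YZ: "(y, z) \<in> E \<longleftrightarrow> (i y \<longleftrightarrow> i z)" if "y \<in> Y" "z \<in> Z" for y z
  proof (cases "y = y0")
    case True
    then show ?thesis
      using y0Z that by simp
  next
    case False
    have "((y, z) \<in> E \<longleftrightarrow> (z, y0) \<in> E) \<longleftrightarrow> ((y0, x0) \<in> E \<longleftrightarrow> (x0, y) \<in> E)"
      using False that base disj adjs adj_sym no_dbl by (intro C4_parity) auto
    then show ?thesis
      using rev[of y0 z] rev[of x0 y0] y0Z[of z] that base by (auto simp: iY iZ)
  qed
  have YX: "(y, x) \<in> E \<longleftrightarrow> \<not> (i x \<longleftrightarrow> i y)" if "x \<in> X" "y \<in> Y" for x y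
    using rev[of x y] XY[of x y] that by simp
  have ZY: "(z, y) \<in> E \<longleftrightarrow> \<not> (i y \<longleftrightarrow> i z)" if "y \<in> Y" "z \<in> Z" for y z
    using rev[of y z] YZ[of y z] that by simp
  have XZ: "(x, z) \<in> E \<longleftrightarrow> \<not> (i z \<longleftrightarrow> i x)" if "x \<in> X" "z \<in> Z" for x z
    using rev[of z x] ZX[of z x] that by simp
  define c where "c A b = {v \<in> A. i v = b}" for A b
  have "arcs_one_way E (c X True) (c Y True \<union> c Z False)" "arcs_one_way E (c Y True) (c Z True \<union> c X False)"
    "arcs_one_way E (c Z True) (c X True \<union> c Y False)" "arcs_one_way E (c X False) (c Y False \<union> c Z True)"
    "arcs_one_way E (c Y False) (c Z False \<union> c X True)" "arcs_one_way E (c Z False) (c X False \<union> c Y True)"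
    by (auto simp: arcs_one_way_def c_def XY YZ ZX YX ZY XZ)
  note ow = this
  have c: "A = c A True \<union> c A False" "c A True \<inter> c A False = {}" for A
    by (auto simp: c_def)
  show ?thesis
    by (rule six_classesI[of X "c X True" "c X False" Y "c Y True" "c Y False" Z "c Z True" "c Z False"]) (fact ow c)+
qed

lemma extremal_six_classes:
  assumes V: "finite V" "card V \<ge> 9" and large: "(card V)\<^sup>2 < 3 * narcs V + 3"
  obtains X Y Z where "tripartition V X Y Z" "six_classes E X Y Z"
    "\<forall>A\<in>{X, Y, Z}. \<forall>B\<in>{X, Y, Z}. card A \<le> card B + 1"
proof -
  obtain X Y Z where part: "tripartition V X Y Z" and no_dbl: "\<not> has_dbl V"
    and bal: "\<forall>A\<in>{X, Y, Z}. \<forall>B\<in>{X, Y, Z}. card A \<le> card B + 1"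
    and adjs: "\<forall>x\<in>X. \<forall>y\<in>Y. adj x y" "\<forall>x\<in>X. \<forall>z\<in>Z. adj x z" "\<forall>y\<in>Y. \<forall>z\<in>Z. adj y z"
    by (rule extremal_tripartition[OF assms]) (rule that; assumption)
  have V_eq: "V = X \<union> Y \<union> Z" and disj: "X \<inter> Y = {}" "X \<inter> Z = {}" "Y \<inter> Z = {}"
    using part by (simp_all add: tripartition_def)
  have "card V = card X + card Y + card Z"
    unfolding V_eq using V disj by (simp add: V_eq card_Un_disjoint Int_Un_distrib2)
  then have "card X \<noteq> 0" "card Y \<noteq> 0" "card Z \<noteq> 0"
    using bal V(2) by auto
  then obtain x0 y0 z0 where base: "x0 \<in> X" "y0 \<in> Y" "z0 \<in> Z"
    by fastforce
  have nd: "\<not> dbl p q" if "p \<in> X \<union> Y \<union> Z" "q \<in> X \<union> Y \<union> Z" for p q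
    using no_dbl that by (auto simp: has_dbl_def V_eq)
  show ?thesis
  proof (cases "((x0, y0) \<in> E \<longleftrightarrow> (y0, z0) \<in> E) \<longleftrightarrow> (z0, x0) \<in> E")
    case True
    then have "six_classes E X Y Z"
      using disj adjs nd base by (intro six_classes_of_even_triangle[of X Y Z x0 y0 z0]) auto
    then show ?thesis
      using that part bal by blast
  next
    case False
    have rev: "(q, p) \<in> E \<longleftrightarrow> (p, q) \<notin> E" if "adj p q" "p \<in> X \<union> Y \<union> Z" "q \<in> X \<union> Y \<union> Z" for p q
      using that nd unfolding adj_def dbl_def by blast
    have "((x0, z0) \<in> E \<longleftrightarrow> (z0, y0) \<in> E) \<longleftrightarrow> (y0, x0) \<in> E"
      using False rev[of x0 y0] rev[of x0 z0] rev[of y0 z0] adjs base by auto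
    then have "six_classes E X Z Y"
    proof (rule six_classes_of_even_triangle[of X Z Y x0 z0 y0, rotated -1])
      show "adj z y" if "z \<in> Z" "y \<in> Y" for z y
        using that adjs adj_sym by blast
    qed (use disj adjs nd base in auto)
    moreover have "tripartition V X Z Y"
      using part by (auto simp: tripartition_def)
    moreover have "\<forall>A\<in>{X, Z, Y}. \<forall>B\<in>{X, Z, Y}. card A \<le> card B + 1"
      using bal by (simp add: insert_commute)
    ultimately show ?thesis
      using that by blast
  qed
qed

lemma narcs_le_third_square:
  assumes "finite V" "card V \<ge> 9"
  shows "narcs V \<le> (card V)\<^sup>2 div 3"
  using narcs_has_dbl[OF assms] turan[OF assms(1)] by fastforce

end

lemma six_classes_no_P13:
  assumes disj: "X \<inter> Y = {}" "X \<inter> Z = {}" "Y \<inter> Z = {}" and E: "E \<subseteq> (X \<union> Y \<union> Z) \<times> (X \<union> Y \<union> Z)"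
    and indep: "\<And>A u w. \<lbrakk>A \<in> {X, Y, Z}; u \<in> A; w \<in> A\<rbrakk> \<Longrightarrow> (u, w) \<notin> E"
    and six: "six_classes E X Y Z"
    and arcs: "(a, b) \<in> E" "(b, c) \<in> E" "(c, d) \<in> E"
  shows "(a, d) \<notin> E"
proof -
  obtain X1 X2 Y1 Y2 Z1 Z2 where
      X: "X = X1 \<union> X2" "X1 \<inter> X2 = {}" and Y: "Y = Y1 \<union> Y2" "Y1 \<inter> Y2 = {}" and Z: "Z = Z1 \<union> Z2" "Z1 \<inter> Z2 = {}"
    and ow: "arcs_one_way E X1 (Y1 \<union> Z2)" "arcs_one_way E Y1 (Z1 \<union> X2)" "arcs_one_way E Z1 (X1 \<union> Y2)"
      "arcs_one_way E X2 (Y2 \<union> Z1)" "arcs_one_way E Y2 (Z2 \<union> X1)" "arcs_one_way E Z2 (X2 \<union> Y1)"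
    using six by (rule six_classesE)
  have V: "w \<in> X1 \<or> w \<in> X2 \<or> w \<in> Y1 \<or> w \<in> Y2 \<or> w \<in> Z1 \<or> w \<in> Z2" if "(u, w) \<in> E \<or> (w, u) \<in> E" for u w
    using that E X Y Z by blast
  have out: "(u \<in> X1 \<longrightarrow> w \<in> Y1 \<or> w \<in> Z2) \<and> (u \<in> Y1 \<longrightarrow> w \<in> Z1 \<or> w \<in> X2) \<and> (u \<in> Z1 \<longrightarrow> w \<in> X1 \<or> w \<in> Y2) \<and>
    (u \<in> X2 \<longrightarrow> w \<in> Y2 \<or> w \<in> Z1) \<and> (u \<in> Y2 \<longrightarrow> w \<in> Z2 \<or> w \<in> X1) \<and> (u \<in> Z2 \<longrightarrow> w \<in> X2 \<or> w \<in> Y1)"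
    if "(u, w) \<in> E" for u w
    using V[of u w] that ow indep[of X u w] indep[of Y u w] indep[of Z u w]
    unfolding arcs_one_way_def X(1) Y(1) Z(1) by blast
  have "\<not> (d \<in> X \<and> d \<in> Y)" "\<not> (d \<in> X \<and> d \<in> Z)" "\<not> (d \<in> Y \<and> d \<in> Z)"
    "\<not> (d \<in> X1 \<and> d \<in> X2)" "\<not> (d \<in> Y1 \<and> d \<in> Y2)" "\<not> (d \<in> Z1 \<and> d \<in> Z2)"
    using disj X(2) Y(2) Z(2) by blast+
  note dis = this[unfolded X(1) Y(1) Z(1) Un_iff]
  show ?thesis
  proof
    assume ad: "(a, d) \<in> E"
    have "a \<in> X1 \<or> a \<in> X2 \<or> a \<in> Y1 \<or> a \<in> Y2 \<or> a \<in> Z1 \<or> a \<in> Z2"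
      using V[of b a] arcs(1) by blast
    then show False
      using out[OF arcs(1)] out[OF arcs(2)] out[OF arcs(3)] out[OF ad] dis by sat
  qed
qed

section \<open>Extremal digraphs\<close>

lemma P13_simps: "pverts P13 = {0, 1, 2, 3}" "parcs P13 = {(0, 1), (1, 2), (2, 3), (0, 3)}"
  by (simp_all add: P13_def)

lemma free_of_P13_iff:
  assumes "pair_digraph D"
  shows "free_of P13 D \<longleftrightarrow> (\<forall>a b c d. distinct [a, b, c, d] \<longrightarrow>
    \<not> ((a, b) \<in> parcs D \<and> (b, c) \<in> parcs D \<and> (c, d) \<in> parcs D \<and> (a, d) \<in> parcs D))"
proof -
  interpret D: pair_digraph D
    by fact
  have wfD: "wf_digraph (with_proj D)"
    by unfold_locales
  have wfP: "wf_digraph (with_proj P13)"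
    by unfold_locales (auto simp: P13_def)
  show ?thesis
  proof (rule iffI; rule ccontr)
    assume free: "free_of P13 D"
    assume "\<not> (\<forall>a b c d. distinct [a, b, c, d] \<longrightarrow>
      \<not> ((a, b) \<in> parcs D \<and> (b, c) \<in> parcs D \<and> (c, d) \<in> parcs D \<and> (a, d) \<in> parcs D))"
    then obtain a b c d where dist: "distinct [a, b, c, d]"
      and arcs: "(a, b) \<in> parcs D" "(b, c) \<in> parcs D" "(c, d) \<in> parcs D" "(a, d) \<in> parcs D"
      by blast
    define g :: "nat \<Rightarrow> 'a" where "g k = (if k = 0 then a else if k = 1 then b else if k = 2 then c else d)" for k
    have g: "g 0 = a" "g 1 = b" "g 2 = c" "g 3 = d"
      by (simp_all add: g_def)
    define f where "f = \<lparr>iso_verts = g, iso_arcs = map_prod g g, iso_head = snd, iso_tail = fst\<rparr>"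
    define K where "K = app_iso f (with_proj P13)"
    have "pre_digraph.digraph_isomorphism (with_proj P13) f"
      unfolding pre_digraph.digraph_isomorphism_def with_proj_simps P13_simps
    proof (intro conjI)
      show "inj_on (iso_verts f) {0, 1, 2, 3}" "inj_on (iso_arcs f) {(0, 1), (1, 2), (2, 3), (0, 3)}"
        using dist by (auto simp: f_def g g[simplified])
    qed (use wfP in \<open>simp_all add: f_def\<close>)
    then have "digraph_iso (with_proj P13) K"
      unfolding digraph_iso_def K_def by blast
    moreover have "subgraph K (with_proj D)"
    proof -
      have K: "verts K = {a, b, c, d}" "arcs K = {(a, b), (b, c), (c, d), (a, d)}" "tail K = fst" "head K = snd"
        by (simp_all add: K_def f_def P13_simps g[simplified])
      have "wf_digraph K"
        by (rule wf_digraph.intro) (auto simp: K)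
      then show ?thesis
        using arcs wfD D.in_arcsD1 D.in_arcsD2 by (auto simp: subgraph_def compatible_def K)
    qed
    ultimately show False
      using free by (auto simp: free_of_def)
  next
    assume free: "\<forall>a b c d. distinct [a, b, c, d] \<longrightarrow>
      \<not> ((a, b) \<in> parcs D \<and> (b, c) \<in> parcs D \<and> (c, d) \<in> parcs D \<and> (a, d) \<in> parcs D)"
    assume "\<not> free_of P13 D"
    then obtain K f where K: "subgraph K (with_proj D)" "K = app_iso f (with_proj P13)"
      and f: "pre_digraph.digraph_isomorphism (with_proj P13) f"
      unfolding free_of_def digraph_iso_def by blast
    note f' = f[unfolded pre_digraph.digraph_isomorphism_def with_proj_simps, THEN conjunct2]
    have inj: "inj_on (iso_verts f) {0, 1, 2, 3}"
      using f'[THEN conjunct1] unfolding P13_simps(1) .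
    have ends: "\<forall>e\<in>parcs P13. iso_verts f (fst e) = iso_tail f (iso_arcs f e) \<and> iso_verts f (snd e) = iso_head f (iso_arcs f e)"
      by (rule f'[THEN conjunct2, THEN conjunct2])
    have sub: "iso_arcs f ` parcs P13 \<subseteq> parcs D" and proj: "iso_tail f = fst" "iso_head f = snd"
      using K unfolding subgraph_def compatible_def by simp_all
    have "(iso_verts f k, iso_verts f l) \<in> parcs D" if "(k, l) \<in> parcs P13" for k l
    proof -
      have "iso_arcs f (k, l) = (iso_verts f k, iso_verts f l)"
        using ends that proj by (metis fst_conv prod.collapse snd_conv)
      then show ?thesis
        using sub that by force
    qed
    note this[of 0 1] this[of 1 2] this[of 2 3] this[of 0 3]
    moreover have "distinct (map (iso_verts f) [0, 1, 2, 3])"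
      unfolding distinct_map using inj by simp
    ultimately show False
      using free[rule_format, of "iso_verts f 0" "iso_verts f 1" "iso_verts f 2" "iso_verts f 3"]
      by (simp add: P13_simps)
  qed
qed

lemma free_digraphs_P13_free:
  assumes "D \<in> free_digraphs n P13"
  shows "P13_free (parcs D)" "finite (pverts D)" "card (pverts D) = n"
    "P13_free.narcs (parcs D) (pverts D) = card (parcs D)"
proof -
  have D: "pair_digraph D" "card (pverts D) = n" "free_of P13 D"
    using assms by (auto simp: free_digraphs_def)
  then interpret D: pair_digraph D
    by simp
  show "P13_free (parcs D)"
  proof
    show "(x, x) \<notin> parcs D" for x
      using D.pair_no_loops by force
    show "(a, d) \<notin> parcs D" if "distinct [a, b, c, d]" "(a, b) \<in> parcs D" "(b, c) \<in> parcs D" "(c, d) \<in> parcs D" for a b c d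
      using D that free_of_P13_iff by blast
  qed
  moreover have "parcs D \<inter> pverts D \<times> pverts D = parcs D"
    using D.in_arcsD1 D.in_arcsD2 by auto
  ultimately show "P13_free.narcs (parcs D) (pverts D) = card (parcs D)"
    by (simp add: P13_free.narcs_def)
  show "finite (pverts D)" "card (pverts D) = n"
    using D by simp_all
qed

lemma S_family_iff:
  "D \<in> S_family n \<longleftrightarrow> pair_digraph D \<and> card (pverts D) = n \<and>
    (\<exists>X Y Z. pverts D = X \<union> Y \<union> Z \<and> X \<inter> Y = {} \<and> X \<inter> Z = {} \<and> Y \<inter> Z = {} \<and>
      (\<forall>A\<in>{X, Y, Z}. \<forall>B\<in>{X, Y, Z}. card A \<le> card B + 1) \<and>
      (\<forall>A\<in>{X, Y, Z}. \<forall>u\<in>A. \<forall>w\<in>A. (u, w) \<notin> parcs D) \<and> six_classes (parcs D) X Y Z)"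
  unfolding S_family_def six_classes_def independent_in_def one_way_def arcs_one_way_def
  by simp

lemma S_familyI:
  assumes "pair_digraph D" "card (pverts D) = n" "pverts D = X \<union> Y \<union> Z" "X \<inter> Y = {}" "X \<inter> Z = {}" "Y \<inter> Z = {}"
    "\<forall>A\<in>{X, Y, Z}. \<forall>B\<in>{X, Y, Z}. card A \<le> card B + 1"
    "\<forall>A\<in>{X, Y, Z}. \<forall>u\<in>A. \<forall>w\<in>A. (u, w) \<notin> parcs D" "six_classes (parcs D) X Y Z"
  shows "D \<in> S_family n"
  unfolding S_family_iff by (intro exI conjI) (fact assms)+

lemma S_familyE:
  assumes "D \<in> S_family n"
  obtains X Y Z where "pair_digraph D" "card (pverts D) = n" "pverts D = X \<union> Y \<union> Z" "X \<inter> Y = {}" "X \<inter> Z = {}" "Y \<inter> Z = {}"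
    "\<forall>A\<in>{X, Y, Z}. \<forall>B\<in>{X, Y, Z}. card A \<le> card B + 1"
    "\<forall>A\<in>{X, Y, Z}. \<forall>u\<in>A. \<forall>w\<in>A. (u, w) \<notin> parcs D" "six_classes (parcs D) X Y Z"
proof -
  obtain X Y Z where "pverts D = X \<union> Y \<union> Z \<and> X \<inter> Y = {} \<and> X \<inter> Z = {} \<and> Y \<inter> Z = {} \<and>
      (\<forall>A\<in>{X, Y, Z}. \<forall>B\<in>{X, Y, Z}. card A \<le> card B + 1) \<and>
      (\<forall>A\<in>{X, Y, Z}. \<forall>u\<in>A. \<forall>w\<in>A. (u, w) \<notin> parcs D) \<and> six_classes (parcs D) X Y Z"
  proof -
    have "\<exists>X Y Z. pverts D = X \<union> Y \<union> Z \<and> X \<inter> Y = {} \<and> X \<inter> Z = {} \<and> Y \<inter> Z = {} \<and>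
        (\<forall>A\<in>{X, Y, Z}. \<forall>B\<in>{X, Y, Z}. card A \<le> card B + 1) \<and>
        (\<forall>A\<in>{X, Y, Z}. \<forall>u\<in>A. \<forall>w\<in>A. (u, w) \<notin> parcs D) \<and> six_classes (parcs D) X Y Z"
      using assms unfolding S_family_iff by (elim conjE)
    then show thesis
      by (elim exE) (rule that)
  qed
  moreover have "pair_digraph D" "card (pverts D) = n"
    using assms by (simp_all add: S_family_def)
  ultimately show ?thesis
    using that by blast
qed

lemma extremal_in_S_family:
  assumes n: "n \<ge> 9" and D: "D \<in> free_digraphs n P13" and card: "card (parcs D) = n\<^sup>2 div 3"
  shows "D \<in> S_family n"
proof -
  note D' = free_digraphs_P13_free[OF D]
  interpret P13_free "parcs D"
    by (rule D')
  have "(card (pverts D))\<^sup>2 < 3 * narcs (pverts D) + 3"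
    using D' card by simp
  moreover have "card (pverts D) \<ge> 9"
    using D' n by simp
  ultimately obtain X Y Z where part: "tripartition (pverts D) X Y Z" and six: "six_classes (parcs D) X Y Z"
    and bal: "\<forall>A\<in>{X, Y, Z}. \<forall>B\<in>{X, Y, Z}. card A \<le> card B + 1"
    using extremal_six_classes[OF D'(2)] by metis
  have "pair_digraph D"
    using D by (simp add: free_digraphs_def)
  then show ?thesis
    by (rule S_familyI[OF _ D'(3) _ _ _ _ bal _ six]) (use part in \<open>auto simp: tripartition_def adj_def\<close>)
qed

lemma S_family_extremal:
  assumes "D \<in> S_family n"
  shows "D \<in> free_digraphs n P13" "card (parcs D) = n\<^sup>2 div 3"
proof -
  obtain X Y Z where D: "pair_digraph D" "card (pverts D) = n"
    and V: "pverts D = X \<union> Y \<union> Z" and disj: "X \<inter> Y = {}" "X \<inter> Z = {}" "Y \<inter> Z = {}"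
    and bal: "\<forall>A\<in>{X, Y, Z}. \<forall>B\<in>{X, Y, Z}. card A \<le> card B + 1"
    and indep: "\<forall>A\<in>{X, Y, Z}. \<forall>u\<in>A. \<forall>w\<in>A. (u, w) \<notin> parcs D" and six: "six_classes (parcs D) X Y Z"
    using assms by (rule S_familyE)
  interpret D: pair_digraph D
    by (rule D)
  have arcs_V: "parcs D \<subseteq> (X \<union> Y \<union> Z) \<times> (X \<union> Y \<union> Z)"
    using D.in_arcsD1 D.in_arcsD2 V by auto
  have "free_of P13 D"
    unfolding free_of_P13_iff[OF D(1)] using six_classes_no_P13[OF disj arcs_V _ six] indep by blast
  then show free: "D \<in> free_digraphs n P13"
    using D by (simp add: free_digraphs_def)
  note D' = free_digraphs_P13_free[OF free]
  interpret P13_free "parcs D"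
    by (rule D')
  obtain X1 X2 Y1 Y2 Z1 Z2 where
      X: "X = X1 \<union> X2" "X1 \<inter> X2 = {}" and Y: "Y = Y1 \<union> Y2" "Y1 \<inter> Y2 = {}" and Z: "Z = Z1 \<union> Z2" "Z1 \<inter> Z2 = {}"
    and ow: "arcs_one_way (parcs D) X1 (Y1 \<union> Z2)" "arcs_one_way (parcs D) Y1 (Z1 \<union> X2)"
      "arcs_one_way (parcs D) Z1 (X1 \<union> Y2)" "arcs_one_way (parcs D) X2 (Y2 \<union> Z1)"
      "arcs_one_way (parcs D) Y2 (Z2 \<union> X1)" "arcs_one_way (parcs D) Z2 (X2 \<union> Y1)"
    using six by (rule six_classesE)
  note ow' = ow[unfolded arcs_one_way_def, rule_format]
  have one: "adj p q \<and> \<not> dbl p q" if "p \<in> X \<and> q \<in> Y \<or> p \<in> X \<and> q \<in> Z \<or> p \<in> Y \<and> q \<in> Z" for p q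
    using that unfolding X(1) Y(1) Z(1) adj_def dbl_def
    by (auto simp: ow')
  have "\<not> dbl p q" if "p \<in> A" "q \<in> A" "A \<in> {X, Y, Z}" for p q A
    using indep that by (auto simp: dbl_def)
  then have "\<not> has_dbl (pverts D)"
    using one dbl_sym unfolding has_dbl_def V by (metis UnE insertCI)
  moreover have "tripartition (pverts D) X Y Z"
    using disj indep by (simp add: tripartition_def adj_def V)
  ultimately have "narcs (pverts D) + card {(x, y) \<in> X \<times> Y. \<not> adj x y} + card {(x, z) \<in> X \<times> Z. \<not> adj x z}
      + card {(y, z) \<in> Y \<times> Z. \<not> adj y z} = card X * card Y + card X * card Z + card Y * card Z"
    by (rule narcs_tripartition[OF D'(2)])
  moreover have "{(x, y) \<in> X \<times> Y. \<not> adj x y} = {}" "{(x, z) \<in> X \<times> Z. \<not> adj x z} = {}"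
    "{(y, z) \<in> Y \<times> Z. \<not> adj y z} = {}"
    using one by blast+
  ultimately have "card (parcs D) = card X * card Y + card X * card Z + card Y * card Z"
    unfolding D'(4) by (simp only: card.empty add_0_right)
  also have "\<dots> = (card X + card Y + card Z)\<^sup>2 div 3"
    using bal by (intro balanced_products_sum) simp
  also have "card X + card Y + card Z = n"
    using D'(2,3) disj unfolding V by (simp add: card_Un_disjoint Int_Un_distrib2)
  finally show "card (parcs D) = n\<^sup>2 div 3" .
qed

lemma S_family_nonempty: "(S_family n :: nat pair_pre_digraph set) \<noteq> {}"
proof -
  define p q where "p = n div 3" and "q = (n + 1) div 3"
  define X where "X = {..<p}"
  define Y where "Y = {p..<p + q}"
  define Z where "Z = {p + q..<n}"
  define D :: "nat pair_pre_digraph" where "D = \<lparr>pverts = {..<n}, parcs = X \<times> Y \<union> Y \<times> Z \<union> Z \<times> X\<rparr>"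
  have pq: "p + q \<le> n" "n - (p + q) = (n + 2) div 3"
    unfolding p_def q_def by presburger+
  have V: "X \<union> Y \<union> Z = {..<n}" and disj: "X \<inter> Y = {}" "X \<inter> Z = {}" "Y \<inter> Z = {}"
    using pq(1) by (auto simp: X_def Y_def Z_def)
  have pd: "pair_digraph D"
  proof
    fix e assume "e \<in> parcs D"
    then show "fst e \<in> pverts D" "snd e \<in> pverts D" "fst e \<noteq> snd e"
      using disj by (auto simp: D_def V[symmetric])
  qed (simp_all add: D_def X_def Y_def Z_def)
  have bal: "card A \<le> card B + 1" if "A \<in> {X, Y, Z}" "B \<in> {X, Y, Z}" for A B
  proof -
    have bounds: "n div 3 \<le> card C \<and> card C \<le> n div 3 + 1" if "C \<in> {X, Y, Z}" for C
      using that pq by (auto simp: X_def Y_def Z_def p_def q_def)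
    then show ?thesis
      using bounds[OF that(1)] bounds[OF that(2)] by linarith
  qed
  have indep: "(u, w) \<notin> parcs D" if "A \<in> {X, Y, Z}" "u \<in> A" "w \<in> A" for A u w
    using that disj by (auto simp: D_def)
  have six: "six_classes (parcs D) X Y Z"
    by (rule six_classesI[of X X "{}" Y Y "{}" Z Z "{}"]) (use disj in \<open>auto simp: arcs_one_way_def D_def\<close>)
  have "D \<in> S_family n"
  proof (rule S_familyI[OF pd _ _ disj _ _ six])
    show "card (pverts D) = n" "pverts D = X \<union> Y \<union> Z"
      by (simp_all add: D_def V)
    show "\<forall>A\<in>{X, Y, Z}. \<forall>B\<in>{X, Y, Z}. card A \<le> card B + 1"
      using bal by blast
    show "\<forall>A\<in>{X, Y, Z}. \<forall>u\<in>A. \<forall>w\<in>A. (u, w) \<notin> parcs D"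
      using indep by blast
  qed
  then show ?thesis
    by blast
qed

lemma S_arcs_eq: "S_arcs n = n\<^sup>2 div 3"
proof -
  have "(\<lambda>D :: nat pair_pre_digraph. card (parcs D)) ` S_family n = {n\<^sup>2 div 3}"
    using S_family_nonempty[of n] S_family_extremal(2) by (auto simp: image_iff)
  then show ?thesis
    unfolding S_arcs_def by simp
qed

lemma ex_arcs_P13:
  assumes "n \<ge> 9"
  shows "ex_arcs n P13 = n\<^sup>2 div 3"
proof -
  have le: "card (parcs D) \<le> n\<^sup>2 div 3" if "D \<in> free_digraphs n P13" for D :: "nat pair_pre_digraph"
    using P13_free.narcs_le_third_square[of "parcs D" "pverts D"] free_digraphs_P13_free[OF that] assms by simp
  obtain D :: "nat pair_pre_digraph" where "D \<in> S_family n"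
    using S_family_nonempty by blast
  then have "n\<^sup>2 div 3 \<in> (\<lambda>D :: nat pair_pre_digraph. card (parcs D)) ` free_digraphs n P13"
    using S_family_extremal by (metis image_eqI)
  then show ?thesis
    unfolding ex_arcs_def using le by (intro Max_eqI) (auto intro: finite_subset[of _ "{..n\<^sup>2 div 3}"])
qed

theorem theorem1p10:
  fixes n :: nat
  assumes "n \<ge> 9"
  shows "ex_arcs n P13 = S_arcs n \<and> int (S_arcs n) = \<lfloor>(real n)\<^sup>2 / 3\<rfloor> \<and>
    (EX_family n P13 :: 'a pair_pre_digraph set) = S_family n"
proof (intro conjI)
  show "ex_arcs n P13 = S_arcs n"
    using ex_arcs_P13[OF assms] by (simp add: S_arcs_eq)
  show "int (S_arcs n) = \<lfloor>(real n)\<^sup>2 / 3\<rfloor>"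
    using floor_divide_of_nat_eq[of "n\<^sup>2" 3, where 'a = real] by (simp add: S_arcs_eq)
  show "(EX_family n P13 :: 'a pair_pre_digraph set) = S_family n"
  proof (intro set_eqI iffI)
    fix D :: "'a pair_pre_digraph"
    show "D \<in> S_family n" if "D \<in> EX_family n P13"
      using extremal_in_S_family[OF assms, of D] ex_arcs_P13[OF assms] that by (simp add: EX_family_def)
    show "D \<in> EX_family n P13" if "D \<in> S_family n"
      using S_family_extremal[OF that] ex_arcs_P13[OF assms] by (simp add: EX_family_def)
  qed
qed

end
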